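(* Let $(X_k)_{k\ge1}$, $\mu$, $H=L^2(\mathbb R,\mathcal B(\mathbb R),\mu)$, $(e_j)_{j\ge1}$, $\Phi$, $\varphi^{(1,1)}$, $\varphi^{(2)}$, $\Phi^{\circ2}$, $a_1^2$, $C$, $\widetilde C$ and the integral $\int\Phi(h)_s\,d\Phi(g)_s$ be as defined in the context. Then for all $h,g\in H$, $$\Phi(h)\Phi(g)=\int\Phi(h)_s\,d\Phi(g)_s+\int\Phi(g)_s\,d\Phi(h)_s+[\Phi(h),\Phi(g)]$$ in $L^2(E,\mathcal E,\nu)$, where $$[\Phi(h),\Phi(g)]:=\bigl(\Phi^{\circ2}+\Phi\circ a_1^2\bigr)\bigl([h\otimes g\,1_\Delta]^\circ\bigr)+\langle h,g\rangle,\qquad \Delta=\{(x,x):x\in\mathbb R\},$$ and $[f]^\circ$ denotes the symmetrization of $f\in H\otimes H$.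
   Context: Setting: $E$ is a normed vector space, $(E,\mathcal E,\nu)$ a probability space, and $(X_k)_{k\ge1}$ a sequence of independent, centered, variance-one real random variables on it such that for every $p>1$ there is a constant $K_p$ with $\sup_k E|X_k|^p<K_p$. $\mu$ is a diffuse (atomless) probability measure on $(\mathbb R,\mathcal B(\mathbb R))$, $H=L^2(\mathbb R,\mathcal B(\mathbb R),\mu)$ (real), with inner product $\langle\cdot,\cdot\rangle$ and Hilbert basis $(e_j)_{j\ge1}$. $H\otimes H$ is identified with $L^2(\mu\otimes\mu)$, with $(h\otimes g)(x,y)=h(x)g(y)$. $C=\{(x,y)\in\mathbb R^2:0\le x<y\le1\}$, $\widetilde C=\{(x,y)\in\mathbb R^2:0\le y<x\le1\}$. Operators: $\Phi:H\to L^2(\nu)$, $\Phi(h)=\sum_{k\ge1}\langle h,e_k\rangle X_k$. For $f\in H\otimes H$, $$\varphi^{(1,1)}(f)=\sum_{j\ge2}\Bigl(\sum_{k=1}^{j-1}\langle f,e_j\otimes e_k\rangle X_k\Bigr)X_j,\qquad \varphi^{(2)}(f)=\sum_{j\ge1}\langle f,e_j\otimes e_j\rangle(X_j^2-1),$$ both converging in $L^2(\nu)$. Integral: for $h,g\in H$, $\int\Phi(h)_s\,d\Phi(g)_s:=\varphi^{(1,1)}(h\otimes g\,1_C+g\otimes h\,1_{\widetilde C})+\varphi^{(2)}(h\otimes g\,1_C)$. Symmetrization: $[f]^\circ(x,y)=\frac12(f(x,y)+f(y,x))$, $e_j\circ e_k=[e_j\otimes e_k]^\circ$, and $H\circ H$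 is the space of symmetric elements of $H\otimes H$. $\Phi^{\circ2}:H\circ H\to L^2(\nu)$ is the continuous linear map with $\Phi^{\circ2}(e_j\circ e_k)=X_jX_k$ for $j\ne k$ and $\Phi^{\circ2}(e_j\circ e_j)=X_j^2-E(X_j^3)X_j-1$. $a_1^2:H\circ H\to H$ is the continuous linear map with $a_1^2(e_j\circ e_k)=0$ for $j\ne k$ and $a_1^2(e_j\circ e_j)=E(X_j^3)\,e_j$.
   Formalization: The formal theorem adds the hypothesis μ([0,1]) = 1; without it the claim for all h, g fails, since C and its mirror image lie in [0,1]² (e.g. μ uniform on [2,3], Gaussian X_k, h = g = e_1 would give X_1² = 1). *)

theory Defs
  imports "HOL-Probability.Probability"
begin

text \<open>
  Elements of an \<open>L\<^sup>2\<close> space are represented by square integrable functions, and equality of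
  elements by equality almost everywhere.
\<close>

definition L2_space :: "'a measure \<Rightarrow> ('a \<Rightarrow> real) set" where
  "L2_space M = {f \<in> borel_measurable M. integrable M (\<lambda>x. (f x)\<^sup>2)}"

definition L2_inner :: "'a measure \<Rightarrow> ('a \<Rightarrow> real) \<Rightarrow> ('a \<Rightarrow> real) \<Rightarrow> real" where
  "L2_inner M f g = (\<integral>x. f x * g x \<partial>M)"

definition L2_norm :: "'a measure \<Rightarrow> ('a \<Rightarrow> real) \<Rightarrow> real" where
  "L2_norm M f = sqrt (L2_inner M f f)"

definition L2_eq :: "'a measure \<Rightarrow> ('a \<Rightarrow> real) \<Rightarrow> ('a \<Rightarrow> real) \<Rightarrow> bool" where
  "L2_eq M f g \<longleftrightarrow> f \<in> L2_space M \<and> g \<in> L2_space M \<and> (AE x in M. f x = g x)"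

text \<open>
  The membership conditions are needed because the Bochner integral of a non-integrable function
  is \<open>0\<close>, so that \<^const>\<open>L2_norm\<close> is meaningless outside \<^const>\<open>L2_space\<close>.
\<close>

definition L2_tendsto :: "'a measure \<Rightarrow> (nat \<Rightarrow> 'a \<Rightarrow> real) \<Rightarrow> ('a \<Rightarrow> real) \<Rightarrow> bool" where
  "L2_tendsto M u f \<longleftrightarrow>
     (\<forall>n. u n \<in> L2_space M) \<and> f \<in> L2_space M \<and>
     (\<lambda>n. L2_norm M (\<lambda>x. u n x - f x)) \<longlonglongrightarrow> 0"

text \<open>A limit is unique only up to equality almost everywhere, hence the choice operator.\<close>

definition L2_lim :: "'a measure \<Rightarrow> (nat \<Rightarrow> 'a \<Rightarrow> real) \<Rightarrow> ('a \<Rightarrow> real)" where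
  "L2_lim M u = (SOME f. L2_tendsto M u f)"

text \<open>Bases and sequences of random variables are indexed by the positive natural numbers.\<close>

definition hilbert_basis :: "'a measure \<Rightarrow> (nat \<Rightarrow> 'a \<Rightarrow> real) \<Rightarrow> bool" where
  "hilbert_basis M e \<longleftrightarrow>
     (\<forall>j\<ge>1. e j \<in> L2_space M) \<and>
     (\<forall>j\<ge>1. \<forall>k\<ge>1. L2_inner M (e j) (e k) = (if j = k then 1 else 0)) \<and>
     (\<forall>f\<in>L2_space M. \<forall>\<epsilon>>0. \<exists>n c. L2_norm M (\<lambda>x. f x - (\<Sum>j=1..n. c j * e j x)) < \<epsilon>)"

text \<open>
  Continuous linear maps from a subspace \<open>V\<close> of \<open>L\<^sup>2(M)\<close> to \<open>L\<^sup>2(N)\<close>. Linearity together with the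
  norm bound makes such a map compatible with equality almost everywhere.
\<close>

definition cont_linear_L2 ::
  "'a measure \<Rightarrow> ('a \<Rightarrow> real) set \<Rightarrow> 'b measure \<Rightarrow> (('a \<Rightarrow> real) \<Rightarrow> 'b \<Rightarrow> real) \<Rightarrow> bool" where
  "cont_linear_L2 M V N T \<longleftrightarrow>
     (\<forall>f\<in>V. T f \<in> L2_space N) \<and>
     (\<forall>f\<in>V. \<forall>g\<in>V. \<forall>a b.
        L2_eq N (T (\<lambda>x. a * f x + b * g x)) (\<lambda>y. a * T f y + b * T g y)) \<and>
     (\<exists>K. \<forall>f\<in>V. L2_norm N (T f) \<le> L2_norm M f * K)"

definition tensor :: "('a \<Rightarrow> real) \<Rightarrow> ('a \<Rightarrow> real) \<Rightarrow> 'a \<times> 'a \<Rightarrow> real" (infixr "\<otimes>\<^sub>f" 75) where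
  "(h \<otimes>\<^sub>f g) = (\<lambda>(x, y). h x * g y)"

definition symmetrize :: "('a \<times> 'a \<Rightarrow> real) \<Rightarrow> 'a \<times> 'a \<Rightarrow> real" where
  "symmetrize f = (\<lambda>(x, y). (f (x, y) + f (y, x)) / 2)"

definition L2_sym :: "'a measure \<Rightarrow> ('a \<times> 'a \<Rightarrow> real) set" where
  "L2_sym M = {f \<in> L2_space (M \<Otimes>\<^sub>M M). AE (x, y) in M \<Otimes>\<^sub>M M. f (x, y) = f (y, x)}"

definition set_C :: "(real \<times> real) set" where
  "set_C = {(x, y). 0 \<le> x \<and> x < y \<and> y \<le> 1}"

definition set_C' :: "(real \<times> real) set" where
  "set_C' = {(x, y). 0 \<le> y \<and> y < x \<and> x \<le> 1}"

definition diagonal :: "(real \<times> real) set" where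
  "diagonal = {(x, x) | x. True}"

text \<open>
  In the following, \<open>N\<close> is the underlying probability space, \<open>X\<close> the sequence of random variables
  on it, \<open>M\<close> the measure defining \<open>H = L\<^sup>2(M)\<close>, and \<open>e\<close> the Hilbert basis of \<open>H\<close>.
\<close>

definition Phi ::
  "'e measure \<Rightarrow> (nat \<Rightarrow> 'e \<Rightarrow> real) \<Rightarrow> 'a measure \<Rightarrow> (nat \<Rightarrow> 'a \<Rightarrow> real) \<Rightarrow>
   ('a \<Rightarrow> real) \<Rightarrow> 'e \<Rightarrow> real" where
  "Phi N X M e h = L2_lim N (\<lambda>n \<omega>. \<Sum>k=1..n. L2_inner M h (e k) * X k \<omega>)"

definition phi11 ::
  "'e measure \<Rightarrow> (nat \<Rightarrow> 'e \<Rightarrow> real) \<Rightarrow> 'a measure \<Rightarrow> (nat \<Rightarrow> 'a \<Rightarrow> real) \<Rightarrow>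
   ('a \<times> 'a \<Rightarrow> real) \<Rightarrow> 'e \<Rightarrow> real" where
  "phi11 N X M e f =
     L2_lim N (\<lambda>n \<omega>. \<Sum>j=2..n.
       (\<Sum>k=1..j-1. L2_inner (M \<Otimes>\<^sub>M M) f (e j \<otimes>\<^sub>f e k) * X k \<omega>) * X j \<omega>)"

definition phi2 ::
  "'e measure \<Rightarrow> (nat \<Rightarrow> 'e \<Rightarrow> real) \<Rightarrow> 'a measure \<Rightarrow> (nat \<Rightarrow> 'a \<Rightarrow> real) \<Rightarrow>
   ('a \<times> 'a \<Rightarrow> real) \<Rightarrow> 'e \<Rightarrow> real" where
  "phi2 N X M e f =
     L2_lim N (\<lambda>n \<omega>. \<Sum>j=1..n.
       L2_inner (M \<Otimes>\<^sub>M M) f (e j \<otimes>\<^sub>f e j) * ((X j \<omega>)\<^sup>2 - 1))"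

text \<open>\<open>Phi_integral N X M e h g\<close> is \<open>\<integral> \<Phi>(h)\<^sub>s d\<Phi>(g)\<^sub>s\<close>: integrand first, integrator second.\<close>

definition Phi_integral ::
  "'e measure \<Rightarrow> (nat \<Rightarrow> 'e \<Rightarrow> real) \<Rightarrow> real measure \<Rightarrow> (nat \<Rightarrow> real \<Rightarrow> real) \<Rightarrow>
   (real \<Rightarrow> real) \<Rightarrow> (real \<Rightarrow> real) \<Rightarrow> 'e \<Rightarrow> real" where
  "Phi_integral N X M e h g = (\<lambda>\<omega>.
     phi11 N X M e (\<lambda>p. (h \<otimes>\<^sub>f g) p * indicator set_C p + (g \<otimes>\<^sub>f h) p * indicator set_C' p) \<omega> +
     phi2 N X M e (\<lambda>p. (h \<otimes>\<^sub>f g) p * indicator set_C p) \<omega>)"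

text \<open>
  The prescribed values on the \<open>e\<^sub>j \<circ> e\<^sub>k\<close> determine the two maps below up to equality almost
  everywhere, since the span of these elements is dense in \<open>H \<circ> H\<close>.
\<close>

definition Phi_circ2 ::
  "'e measure \<Rightarrow> (nat \<Rightarrow> 'e \<Rightarrow> real) \<Rightarrow> 'a measure \<Rightarrow> (nat \<Rightarrow> 'a \<Rightarrow> real) \<Rightarrow>
   ('a \<times> 'a \<Rightarrow> real) \<Rightarrow> 'e \<Rightarrow> real" where
  "Phi_circ2 N X M e = (SOME T.
     cont_linear_L2 (M \<Otimes>\<^sub>M M) (L2_sym M) N T \<and>
     (\<forall>j\<ge>1. \<forall>k\<ge>1. j \<noteq> k \<longrightarrow>
        L2_eq N (T (symmetrize (e j \<otimes>\<^sub>f e k))) (\<lambda>\<omega>. X j \<omega> * X k \<omega>)) \<and>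
     (\<forall>j\<ge>1. L2_eq N (T (symmetrize (e j \<otimes>\<^sub>f e j)))
        (\<lambda>\<omega>. (X j \<omega>)\<^sup>2 - (\<integral>\<omega>'. (X j \<omega>') ^ 3 \<partial>N) * X j \<omega> - 1)))"

definition a12 ::
  "'e measure \<Rightarrow> (nat \<Rightarrow> 'e \<Rightarrow> real) \<Rightarrow> 'a measure \<Rightarrow> (nat \<Rightarrow> 'a \<Rightarrow> real) \<Rightarrow>
   ('a \<times> 'a \<Rightarrow> real) \<Rightarrow> 'a \<Rightarrow> real" where
  "a12 N X M e = (SOME T.
     cont_linear_L2 (M \<Otimes>\<^sub>M M) (L2_sym M) M T \<and>
     (\<forall>j\<ge>1. \<forall>k\<ge>1. j \<noteq> k \<longrightarrow> L2_eq M (T (symmetrize (e j \<otimes>\<^sub>f e k))) (\<lambda>_. 0)) \<and>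
     (\<forall>j\<ge>1. L2_eq M (T (symmetrize (e j \<otimes>\<^sub>f e j)))
        (\<lambda>x. (\<integral>\<omega>. (X j \<omega>) ^ 3 \<partial>N) * e j x)))"

definition Phi_bracket ::
  "'e measure \<Rightarrow> (nat \<Rightarrow> 'e \<Rightarrow> real) \<Rightarrow> real measure \<Rightarrow> (nat \<Rightarrow> real \<Rightarrow> real) \<Rightarrow>
   (real \<Rightarrow> real) \<Rightarrow> (real \<Rightarrow> real) \<Rightarrow> 'e \<Rightarrow> real" where
  "Phi_bracket N X M e h g =
     (let d = symmetrize (\<lambda>p. (h \<otimes>\<^sub>f g) p * indicator diagonal p)
      in (\<lambda>\<omega>. (Phi_circ2 N X M e d \<omega> + Phi N X M e (a12 N X M e d) \<omega>) + L2_inner M h g))"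

end

theory Submission
  imports Defs
begin

text \<open>
  Put \<open>h\<^sub>j = \<langle>h, e\<^sub>j\<rangle>\<close> and \<open>g\<^sub>j = \<langle>g, e\<^sub>j\<rangle>\<close>. The partial sums of \<open>\<Phi>(h)\<close> and \<open>\<Phi>(g)\<close> multiply to
  \<open>\<Sum>\<^bsub>k<j\<^esub> (h\<^sub>j g\<^sub>k + g\<^sub>j h\<^sub>k) X\<^sub>k X\<^sub>j + \<Sum>\<^sub>j h\<^sub>j g\<^sub>j (X\<^sub>j\<^sup>2 - 1) + \<Sum>\<^sub>j h\<^sub>j g\<^sub>j\<close>.
  Since \<open>\<mu>\<close> is diffuse and carried by \<open>[0, 1]\<close>, the two triangles exhaust the square up to a null set,
  so the first two sums are the partial sums of the two integrals together. They converge in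
  \<open>L\<^sup>2\<close> because the \<open>X\<^sub>k X\<^sub>j\<close> and the \<open>X\<^sub>j\<^sup>2 - 1\<close> are bounded orthogonal families. The last sum
  tends to \<open>\<langle>h, g\<rangle>\<close> by Parseval, whereas the products converge to \<open>\<Phi>(h) \<Phi>(g)\<close> in \<open>L\<^sup>1\<close> only; the two
  limits agree almost everywhere. The bracket reduces to \<open>\<langle>h, g\<rangle>\<close>, since the diagonal is a null set
  and \<open>\<Phi>\<^bsup>\<circ>2\<^esup>\<close> and \<open>a\<^sub>1\<^sup>2\<close> are continuous and linear; this needs the existence of these two maps.
\<close>

subsection \<open>Square integrable functions\<close>

lemma L2_spaceD:
  assumes "f \<in> L2_space M"
  shows "f \<in> borel_measurable M" "integrable M (\<lambda>x. (f x)\<^sup>2)"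
  using assms by (auto simp: L2_space_def)

text \<open>Domination by the sum of the squares. Additivity of the inner product rests on this,
  because the Bochner integral is additive only on integrable functions.\<close>

lemma L2_space_mult_integrable:
  assumes "f \<in> L2_space M" "g \<in> L2_space M"
  shows "integrable M (\<lambda>x. f x * g x)"
proof (rule Bochner_Integration.integrable_bound)
  show "integrable M (\<lambda>x. (f x)\<^sup>2 + (g x)\<^sup>2)"
    using assms by (intro Bochner_Integration.integrable_add L2_spaceD)
  show "(\<lambda>x. f x * g x) \<in> borel_measurable M"
    using assms by (intro borel_measurable_times L2_spaceD)
  have "\<bar>a * b\<bar> \<le> a\<^sup>2 + b\<^sup>2" for a b :: real
  proof -
    have "\<bar>a\<bar> * \<bar>b\<bar> \<ge> 0" by simp
    with sum_squares_bound[of "\<bar>a\<bar>" "\<bar>b\<bar>"] show ?thesis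
      by (simp only: power2_abs mult.assoc abs_mult)
  qed
  then show "AE x in M. norm (f x * g x) \<le> norm ((f x)\<^sup>2 + (g x)\<^sup>2)"
    by (simp add: abs_mult)
qed

lemma L2_space_zero: "(\<lambda>x. 0) \<in> L2_space M"
  by (simp add: L2_space_def)

lemma L2_space_add:
  assumes f: "f \<in> L2_space M" and g: "g \<in> L2_space M"
  shows "(\<lambda>x. f x + g x) \<in> L2_space M"
proof -
  have "integrable M (\<lambda>x. (f x)\<^sup>2 + (g x)\<^sup>2 + 2 * (f x * g x))"
    by (intro Bochner_Integration.integrable_add integrable_mult_right L2_spaceD f g L2_space_mult_integrable)
  then show ?thesis
    using f g by (auto simp: L2_space_def power2_sum algebra_simps)
qed

lemma L2_space_cmult: "f \<in> L2_space M \<Longrightarrow> (\<lambda>x. c * f x) \<in> L2_space M"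
  by (auto simp: L2_space_def power_mult_distrib)

lemma L2_space_diff:
  assumes "f \<in> L2_space M" "g \<in> L2_space M"
  shows "(\<lambda>x. f x - g x) \<in> L2_space M"
  using L2_space_add[OF assms(1) L2_space_cmult[OF assms(2), of "-1"]] by simp

lemma L2_space_sum:
  "(\<And>i. i \<in> A \<Longrightarrow> f i \<in> L2_space M) \<Longrightarrow> (\<lambda>x. \<Sum>i\<in>A. f i x) \<in> L2_space M"
  by (induction A rule: infinite_finite_induct) (auto intro: L2_space_add L2_space_zero)

lemma L2_space_abs: "f \<in> L2_space M \<Longrightarrow> (\<lambda>x. \<bar>f x\<bar>) \<in> L2_space M"
  by (auto simp: L2_space_def)

lemma (in finite_measure) L2_space_const: "(\<lambda>x. c) \<in> L2_space M"
  by (simp add: L2_space_def)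

lemma (in finite_measure) L2_space_integrable: "f \<in> L2_space M \<Longrightarrow> integrable M f"
  using L2_space_mult_integrable[OF _ L2_space_const[of 1]] by simp

text \<open>Measurability of \<open>g\<close> is assumed separately: the measure may be incomplete,
  so changing a measurable function on a null set can destroy measurability.\<close>

lemma L2_space_cong_AE:
  assumes "f \<in> L2_space M" "g \<in> borel_measurable M" "AE x in M. f x = g x"
  shows "g \<in> L2_space M"
proof -
  have [measurable]: "f \<in> borel_measurable M" "g \<in> borel_measurable M"
    using assms by (auto dest: L2_spaceD)
  have "integrable M (\<lambda>x. (f x)\<^sup>2) \<longleftrightarrow> integrable M (\<lambda>x. (g x)\<^sup>2)"
    using assms(3) by (intro integrable_cong_AE) auto
  then show ?thesis using assms by (auto simp: L2_space_def)
qed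

lemma L2_space_mult_indicator:
  assumes "f \<in> L2_space M" "A \<in> sets M"
  shows "(\<lambda>x. f x * indicator A x) \<in> L2_space M"
proof -
  have "(\<lambda>x. (f x * indicator A x)\<^sup>2) = (\<lambda>x. (f x)\<^sup>2 * indicator A x)"
    by (auto simp: fun_eq_iff split: split_indicator)
  moreover have "(\<lambda>x. f x * indicator A x) \<in> borel_measurable M"
    using assms L2_spaceD(1)[OF assms(1)] by measurable
  ultimately show ?thesis
    using assms integrable_real_mult_indicator[OF assms(2) L2_spaceD(2)[OF assms(1)]]
    by (simp add: L2_space_def)
qed

section \<open>Inner product and norm\<close>

lemma L2_inner_commute: "L2_inner M f g = L2_inner M g f"
  by (simp add: L2_inner_def mult.commute)

lemma L2_inner_self_nonneg: "0 \<le> L2_inner M f f"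
  by (simp add: L2_inner_def)

lemma L2_inner_add_left:
  assumes "f \<in> L2_space M" "g \<in> L2_space M" "k \<in> L2_space M"
  shows "L2_inner M (\<lambda>x. f x + g x) k = L2_inner M f k + L2_inner M g k"
  using assms by (simp add: L2_inner_def ring_distribs L2_space_mult_integrable)

lemma L2_inner_diff_left:
  assumes "f \<in> L2_space M" "g \<in> L2_space M" "k \<in> L2_space M"
  shows "L2_inner M (\<lambda>x. f x - g x) k = L2_inner M f k - L2_inner M g k"
  using assms by (simp add: L2_inner_def ring_distribs L2_space_mult_integrable)

lemma L2_inner_cmult_left: "L2_inner M (\<lambda>x. c * f x) k = c * L2_inner M f k"
  by (simp add: L2_inner_def mult.assoc)

lemma L2_inner_cmult_right: "L2_inner M k (\<lambda>x. c * f x) = c * L2_inner M k f"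
  by (simp add: L2_inner_def mult.left_commute)

lemma L2_inner_sum_left:
  assumes "\<And>i. i \<in> A \<Longrightarrow> f i \<in> L2_space M" "k \<in> L2_space M"
  shows "L2_inner M (\<lambda>x. \<Sum>i\<in>A. f i x) k = (\<Sum>i\<in>A. L2_inner M (f i) k)"
  using assms by (simp add: L2_inner_def sum_distrib_right L2_space_mult_integrable)

lemma L2_inner_cong_AE:
  assumes "f \<in> borel_measurable M" "f' \<in> borel_measurable M" "g \<in> borel_measurable M"
    "AE x in M. f x = f' x"
  shows "L2_inner M f g = L2_inner M f' g"
  unfolding L2_inner_def using assms by (intro integral_cong_AE) auto

lemma L2_norm_nonneg: "0 \<le> L2_norm M f"
  by (simp add: L2_norm_def L2_inner_self_nonneg)

lemma L2_norm_sq: "(L2_norm M f)\<^sup>2 = L2_inner M f f"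
  by (simp add: L2_norm_def L2_inner_self_nonneg)

lemma L2_norm_cmult: "L2_norm M (\<lambda>x. c * f x) = \<bar>c\<bar> * L2_norm M f"
  by (simp add: L2_norm_def L2_inner_cmult_left L2_inner_cmult_right real_sqrt_mult flip: mult.assoc)

lemma L2_norm_abs: "L2_norm M (\<lambda>x. \<bar>f x\<bar>) = L2_norm M f"
  by (simp add: L2_norm_def L2_inner_def)

lemma L2_norm_diff_commute: "L2_norm M (\<lambda>x. f x - g x) = L2_norm M (\<lambda>x. g x - f x)"
  using L2_norm_cmult[of M "-1" "\<lambda>x. g x - f x"] by simp

lemma L2_norm_eq_0_iff:
  assumes "f \<in> L2_space M"
  shows "L2_norm M f = 0 \<longleftrightarrow> (AE x in M. f x = 0)"
proof -
  have "L2_norm M f = 0 \<longleftrightarrow> (\<integral>x. (f x)\<^sup>2 \<partial>M) = 0"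
    by (simp add: L2_norm_def L2_inner_def power2_eq_square)
  also have "\<dots> \<longleftrightarrow> (AE x in M. (f x)\<^sup>2 = 0)"
    using assms by (intro integral_nonneg_eq_0_iff_AE) (auto dest: L2_spaceD)
  finally show ?thesis by simp
qed

text \<open>The quadratic polynomial in \<open>t\<close> behind three later facts: all
  \<open>t\<close> for Cauchy-Schwarz, \<open>t = 1\<close> for the triangle inequality,
  \<open>t = -1\<close> for the error of an orthogonal approximation.\<close>

lemma L2_inner_add_cmult_self:
  assumes f: "f \<in> L2_space M" and g: "g \<in> L2_space M"
  shows "L2_inner M (\<lambda>x. f x + t * g x) (\<lambda>x. f x + t * g x)
    = L2_inner M f f + 2 * t * L2_inner M f g + t\<^sup>2 * L2_inner M g g"
proof -
  have "(\<integral>x. (f x + t * g x) * (f x + t * g x) \<partial>M)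
      = (\<integral>x. f x * f x + 2 * t * (f x * g x) + t\<^sup>2 * (g x * g x) \<partial>M)"
    by (intro Bochner_Integration.integral_cong) (auto simp: power2_eq_square algebra_simps)
  then show ?thesis
    using f g by (simp add: L2_inner_def L2_space_mult_integrable)
qed

lemma L2_inner_Cauchy_Schwarz:
  assumes f: "f \<in> L2_space M" and g: "g \<in> L2_space M"
  shows "\<bar>L2_inner M f g\<bar> \<le> L2_norm M f * L2_norm M g"
proof -
  define a b c where "a = L2_inner M f f" and "b = L2_inner M f g" and "c = L2_inner M g g"
  have *: "0 \<le> a - 2 * t * b + t\<^sup>2 * c" for t
    using L2_inner_self_nonneg[of M "\<lambda>x. f x + (- t) * g x"]
    by (simp only: L2_inner_add_cmult_self[OF f g]) (simp add: a_def b_def c_def)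
  have a: "0 \<le> a" and c: "0 \<le> c" by (simp_all add: a_def c_def L2_inner_self_nonneg)
  have "b\<^sup>2 \<le> a * c"
  proof (cases "c = 0")
    case True
    have "b = 0"
    proof (rule ccontr)
      assume "b \<noteq> 0"
      \<comment> \<open>With \<open>c = 0\<close> the polynomial is affine in \<open>t\<close>; this
        value of \<open>t\<close> turns it into \<open>a - (a + 1) = -1\<close>.\<close>
      then show False using *[of "(a + 1) / (2 * b)"] True a by (simp add: field_simps)
    qed
    with True show ?thesis by simp
  next
    case False
    \<comment> \<open>The polynomial attains its minimum at \<open>t = b / c\<close>.\<close>
    with *[of "b / c"] c show ?thesis by (simp add: field_simps power2_eq_square)
  qed
  then have "sqrt (b\<^sup>2) \<le> sqrt (a * c)" by (rule real_sqrt_le_mono)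
  then show ?thesis by (simp add: L2_norm_def a_def b_def c_def real_sqrt_mult)
qed

lemma L2_norm_triangle:
  assumes f: "f \<in> L2_space M" and g: "g \<in> L2_space M"
  shows "L2_norm M (\<lambda>x. f x + g x) \<le> L2_norm M f + L2_norm M g"
proof (rule power2_le_imp_le)
  have "(L2_norm M (\<lambda>x. f x + g x))\<^sup>2 = L2_inner M f f + 2 * L2_inner M f g + L2_inner M g g"
    using L2_inner_add_cmult_self[OF f g, of 1] by (simp add: L2_norm_sq)
  also have "\<dots> \<le> (L2_norm M f + L2_norm M g)\<^sup>2"
    using L2_inner_Cauchy_Schwarz[OF f g] by (simp add: power2_sum L2_norm_sq mult.assoc)
  finally show "(L2_norm M (\<lambda>x. f x + g x))\<^sup>2 \<le> (L2_norm M f + L2_norm M g)\<^sup>2" .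
qed (simp add: L2_norm_nonneg)

lemma L2_norm_diff_triangle:
  assumes "f \<in> L2_space M" "g \<in> L2_space M" "k \<in> L2_space M"
  shows "L2_norm M (\<lambda>x. f x - k x) \<le> L2_norm M (\<lambda>x. f x - g x) + L2_norm M (\<lambda>x. g x - k x)"
  using L2_norm_triangle[OF L2_space_diff[OF assms(1,2)] L2_space_diff[OF assms(2,3)]] by simp

lemma integral_abs_mult_le_L2_norm:
  assumes "f \<in> L2_space M" "g \<in> L2_space M"
  shows "(\<integral>x. \<bar>f x * g x\<bar> \<partial>M) \<le> L2_norm M f * L2_norm M g"
  using L2_inner_Cauchy_Schwarz[OF assms[THEN L2_space_abs]]
  by (simp add: L2_inner_def L2_norm_abs abs_mult)

text \<open>Cauchy-Schwarz against the constant 1, which has norm 1 on a probability space.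
  Convergence in L2 therefore implies convergence in L1.\<close>

lemma (in prob_space) integral_abs_le_L2_norm:
  assumes "f \<in> L2_space M"
  shows "(\<integral>x. \<bar>f x\<bar> \<partial>M) \<le> L2_norm M f"
  using integral_abs_mult_le_L2_norm[OF assms L2_space_const[of 1]]
  by (simp add: L2_norm_def[of M "\<lambda>_. 1"] L2_inner_def prob_space)

lemma L2_eqI: "f \<in> L2_space M \<Longrightarrow> g \<in> L2_space M \<Longrightarrow> AE x in M. f x = g x \<Longrightarrow> L2_eq M f g"
  by (simp add: L2_eq_def)

lemma L2_eq_trans: "L2_eq M f g \<Longrightarrow> L2_eq M g k \<Longrightarrow> L2_eq M f k"
  by (auto simp: L2_eq_def)

lemma L2_eq_sym: "L2_eq M f g \<Longrightarrow> L2_eq M g f"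
  by (auto simp: L2_eq_def)


subsection \<open>Convergence in the mean\<close>

lemma L2_tendsto_const: "f \<in> L2_space M \<Longrightarrow> L2_tendsto M (\<lambda>n. f) f"
  by (simp add: L2_tendsto_def L2_norm_def L2_inner_def)

lemma L2_tendsto_add:
  assumes "L2_tendsto M u f" "L2_tendsto M v g"
  shows "L2_tendsto M (\<lambda>n x. u n x + v n x) (\<lambda>x. f x + g x)"
proof -
  note [simp] = assms[unfolded L2_tendsto_def]
  have "(\<lambda>n. L2_norm M (\<lambda>x. (u n x + v n x) - (f x + g x))) \<longlonglongrightarrow> 0"
  proof (rule tendsto_sandwich[OF _ _ tendsto_const])
    show "\<forall>\<^sub>F n in sequentially. 0 \<le> L2_norm M (\<lambda>x. (u n x + v n x) - (f x + g x))"
      by (simp add: L2_norm_nonneg)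
    show "(\<lambda>n. L2_norm M (\<lambda>x. u n x - f x) + L2_norm M (\<lambda>x. v n x - g x)) \<longlonglongrightarrow> 0"
      by (auto intro!: tendsto_add_zero)
    have "L2_norm M (\<lambda>x. (u n x + v n x) - (f x + g x))
      \<le> L2_norm M (\<lambda>x. u n x - f x) + L2_norm M (\<lambda>x. v n x - g x)" for n
      using L2_norm_triangle[of "\<lambda>x. u n x - f x" M "\<lambda>x. v n x - g x"]
      by (simp add: L2_space_diff add_diff_add)
    then show "\<forall>\<^sub>F n in sequentially. L2_norm M (\<lambda>x. (u n x + v n x) - (f x + g x))
      \<le> L2_norm M (\<lambda>x. u n x - f x) + L2_norm M (\<lambda>x. v n x - g x)" by simp
  qed
  then show ?thesis by (simp add: L2_tendsto_def L2_space_add)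
qed

lemma L2_tendsto_cmult:
  assumes "L2_tendsto M u f"
  shows "L2_tendsto M (\<lambda>n x. c * u n x) (\<lambda>x. c * f x)"
  using assms tendsto_mult_right_zero[of "\<lambda>n. L2_norm M (\<lambda>x. u n x - f x)" sequentially "\<bar>c\<bar>"]
  by (simp add: L2_tendsto_def L2_space_cmult L2_norm_cmult flip: right_diff_distrib)

lemma L2_tendsto_unique:
  assumes "L2_tendsto M u f" "L2_tendsto M u g"
  shows "L2_eq M f g"
proof -
  note [simp] = assms[unfolded L2_tendsto_def]
  have "L2_norm M (\<lambda>x. f x - g x) \<le> 0"
  proof (rule LIMSEQ_le_const)
    show "(\<lambda>n. L2_norm M (\<lambda>x. u n x - f x) + L2_norm M (\<lambda>x. u n x - g x)) \<longlonglongrightarrow> 0"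
      by (auto intro!: tendsto_add_zero)
    show "\<exists>N. \<forall>n\<ge>N. L2_norm M (\<lambda>x. f x - g x)
        \<le> L2_norm M (\<lambda>x. u n x - f x) + L2_norm M (\<lambda>x. u n x - g x)"
      using L2_norm_diff_triangle[of f M "u _" g] by (simp add: L2_norm_diff_commute[of M f])
  qed
  then have "L2_norm M (\<lambda>x. f x - g x) = 0" using L2_norm_nonneg[of M] by (simp add: antisym)
  then show ?thesis by (simp add: L2_eq_def L2_norm_eq_0_iff L2_space_diff)
qed

text \<open>Once some limit is known to exist, the choice operator returns one. Series defined by
  \<open>L2_lim\<close> are accessed through this fact.\<close>

lemma L2_lim_tendsto: "L2_tendsto M u f \<Longrightarrow> L2_tendsto M u (L2_lim M u)"
  unfolding L2_lim_def by (rule someI[of "L2_tendsto M u"])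

lemma L2_tendsto_norm:
  assumes "L2_tendsto M u f"
  shows "(\<lambda>n. L2_norm M (u n)) \<longlonglongrightarrow> L2_norm M f"
proof (rule LIM_zero_cancel, rule Lim_null_comparison)
  note [simp] = assms[unfolded L2_tendsto_def]
  show "(\<lambda>n. L2_norm M (\<lambda>x. u n x - f x)) \<longlonglongrightarrow> 0" by simp
  have "\<bar>L2_norm M (u n) - L2_norm M f\<bar> \<le> L2_norm M (\<lambda>x. u n x - f x)" for n
    using L2_norm_diff_triangle[of "u n" M f "\<lambda>x. 0"] L2_norm_diff_triangle[of f M "u n" "\<lambda>x. 0"]
    by (simp add: L2_norm_diff_commute[of M f] L2_space_zero)
  then show "\<forall>\<^sub>F n in sequentially. norm (L2_norm M (u n) - L2_norm M f) \<le> L2_norm M (\<lambda>x. u n x - f x)"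
    by simp
qed

text \<open>Riesz-Fischer. A Cauchy sequence in L2 is Cauchy in L1, so a subsequence converges
  almost everywhere; Fatou's lemma along that subsequence bounds the L2 distance of the whole
  sequence to the pointwise limit.\<close>

lemma (in prob_space) L2_complete:
  assumes u: "\<And>n. u n \<in> L2_space M"
    and Cauchy: "\<And>\<epsilon>. \<epsilon> > 0 \<Longrightarrow> \<exists>N. \<forall>m\<ge>N. \<forall>n\<ge>N. L2_norm M (\<lambda>x. u m x - u n x) < \<epsilon>"
  obtains f where "L2_tendsto M u f"
proof -
  have um [measurable]: "u n \<in> borel_measurable M" for n
    using u by (rule L2_spaceD)
  obtain r where r: "strict_mono r" and ae: "AE x in M. Cauchy (\<lambda>i. u (r i) x)"
  proof (rule cauchy_L1_AE_cauchy_subseq)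
    show "integrable M (u n)" for n using u by (rule L2_space_integrable)
    fix \<epsilon> :: real assume "0 < \<epsilon>"
    with Cauchy obtain N where N: "\<forall>m\<ge>N. \<forall>n\<ge>N. L2_norm M (\<lambda>x. u m x - u n x) < \<epsilon>" by blast
    have "(\<integral>x. norm (u i x - u j x) \<partial>M) < \<epsilon>" if "i \<ge> N" "j \<ge> N" for i j
      using integral_abs_le_L2_norm[OF L2_space_diff[OF u[of i] u[of j]]] N that
      by (simp add: order.strict_trans1)
    then show "\<exists>N. \<forall>i\<ge>N. \<forall>j\<ge>N. (\<integral>x. norm (u i x - u j x) \<partial>M) < \<epsilon>"
      by blast
  qed
  \<comment> \<open>Where the subsequence diverges, \<open>lim\<close> takes one fixed unspecified
    value, so \<open>f\<close> is measurable on the whole space.\<close>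
  define f where "f x = lim (\<lambda>i. u (r i) x)" for x
  have fm [measurable]: "f \<in> borel_measurable M" unfolding f_def by measurable
  have ae: "AE x in M. (\<lambda>i. u (r i) x) \<longlonglongrightarrow> f x"
    using ae by eventually_elim (unfold f_def, metis Cauchy_convergent convergent_LIMSEQ_iff)
  \<comment> \<open>Membership and norm bound are proved together: the Fatou estimate is made for
    the nonnegative integral, and it yields the integrability without which the norm would carry no
    information.\<close>
  have key: "(\<lambda>x. u n x - f x) \<in> L2_space M \<and> L2_norm M (\<lambda>x. u n x - f x) \<le> \<epsilon>"
    if "\<epsilon> > 0" and N: "\<forall>m\<ge>N. \<forall>n\<ge>N. L2_norm M (\<lambda>x. u m x - u n x) < \<epsilon>" and n: "n \<ge> N" for n N \<epsilon>
  proof -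
    have "(\<integral>\<^sup>+x. ennreal ((u n x - f x)\<^sup>2) \<partial>M)
        = (\<integral>\<^sup>+x. liminf (\<lambda>k. ennreal ((u n x - u (r k) x)\<^sup>2)) \<partial>M)"
    proof (rule nn_integral_cong_AE, use ae in eventually_elim)
      fix x assume "(\<lambda>i. u (r i) x) \<longlonglongrightarrow> f x"
      then have "(\<lambda>k. ennreal ((u n x - u (r k) x)\<^sup>2)) \<longlonglongrightarrow> ennreal ((u n x - f x)\<^sup>2)"
        by (intro tendsto_ennrealI tendsto_intros)
      then show "ennreal ((u n x - f x)\<^sup>2) = liminf (\<lambda>k. ennreal ((u n x - u (r k) x)\<^sup>2))"
        using lim_imp_Liminf by (metis trivial_limit_sequentially)
    qed
    also have "\<dots> \<le> liminf (\<lambda>k. \<integral>\<^sup>+x. ennreal ((u n x - u (r k) x)\<^sup>2) \<partial>M)"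
      by (rule nn_integral_liminf) measurable
    also have "\<dots> \<le> limsup (\<lambda>k. \<integral>\<^sup>+x. ennreal ((u n x - u (r k) x)\<^sup>2) \<partial>M)"
      by (rule Liminf_le_Limsup) simp
    also have "\<dots> \<le> ennreal (\<epsilon>\<^sup>2)"
    proof (rule Limsup_bounded)
      have "(\<integral>\<^sup>+x. ennreal ((u n x - u (r k) x)\<^sup>2) \<partial>M) \<le> ennreal (\<epsilon>\<^sup>2)" if "k \<ge> N" for k
      proof -
        have "r k \<ge> N" using seq_suble[OF r, of k] that by simp
        then have "L2_norm M (\<lambda>x. u n x - u (r k) x) \<le> \<epsilon>" using N n by (simp add: less_imp_le)
        then have "(L2_norm M (\<lambda>x. u n x - u (r k) x))\<^sup>2 \<le> \<epsilon>\<^sup>2"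
          by (intro power_mono L2_norm_nonneg)
        then have "(\<integral>x. (u n x - u (r k) x)\<^sup>2 \<partial>M) \<le> \<epsilon>\<^sup>2"
          by (simp add: L2_norm_sq L2_inner_def flip: power2_eq_square)
        moreover have "(\<integral>\<^sup>+x. ennreal ((u n x - u (r k) x)\<^sup>2) \<partial>M)
            = ennreal (\<integral>x. (u n x - u (r k) x)\<^sup>2 \<partial>M)"
          by (intro nn_integral_eq_integral L2_spaceD L2_space_diff u) simp
        ultimately show ?thesis by (simp add: ennreal_leI)
      qed
      then show "\<forall>\<^sub>F k in sequentially. (\<integral>\<^sup>+x. ennreal ((u n x - u (r k) x)\<^sup>2) \<partial>M) \<le> ennreal (\<epsilon>\<^sup>2)"
        by (auto simp: eventually_sequentially)
    qed
    finally have le: "(\<integral>\<^sup>+x. ennreal ((u n x - f x)\<^sup>2) \<partial>M) \<le> ennreal (\<epsilon>\<^sup>2)" .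
    then have "(\<integral>\<^sup>+x. ennreal ((u n x - f x)\<^sup>2) \<partial>M) < \<infinity>"
      by (rule le_less_trans) simp
    then have int: "integrable M (\<lambda>x. (u n x - f x)\<^sup>2)"
      by (intro integrableI_bounded) auto
    then have "ennreal (\<integral>x. (u n x - f x)\<^sup>2 \<partial>M) \<le> ennreal (\<epsilon>\<^sup>2)"
      using le by (simp add: nn_integral_eq_integral)
    then have "L2_inner M (\<lambda>x. u n x - f x) (\<lambda>x. u n x - f x) \<le> \<epsilon>\<^sup>2"
      by (simp add: L2_inner_def power2_eq_square)
    then have "L2_norm M (\<lambda>x. u n x - f x) \<le> \<epsilon>"
      unfolding L2_norm_def using \<open>\<epsilon> > 0\<close> by (intro real_le_lsqrt) simp_all
    with int show ?thesis by (simp add: L2_space_def)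
  qed
  have "f \<in> L2_space M"
  proof -
    obtain N where "\<forall>m\<ge>N. \<forall>n\<ge>N. L2_norm M (\<lambda>x. u m x - u n x) < 1" using Cauchy[of 1] by auto
    then have "(\<lambda>x. u N x - f x) \<in> L2_space M" using key[of 1 N N] by simp
    from L2_space_diff[OF u[of N] this] show ?thesis by simp
  qed
  moreover have "(\<lambda>n. L2_norm M (\<lambda>x. u n x - f x)) \<longlonglongrightarrow> 0"
  proof (rule LIMSEQ_I)
    fix \<epsilon> :: real assume "0 < \<epsilon>"
    then obtain N where "\<forall>m\<ge>N. \<forall>n\<ge>N. L2_norm M (\<lambda>x. u m x - u n x) < \<epsilon> / 2"
      using Cauchy[of "\<epsilon> / 2"] by auto
    then have "L2_norm M (\<lambda>x. u n x - f x) < \<epsilon>" if "n \<ge> N" for n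
      using key[of "\<epsilon> / 2" N n] \<open>0 < \<epsilon>\<close> that by simp
    then show "\<exists>N. \<forall>n\<ge>N. norm (L2_norm M (\<lambda>x. u n x - f x) - 0) < \<epsilon>"
      by (auto simp: L2_norm_nonneg)
  qed
  ultimately show thesis using u that by (simp add: L2_tendsto_def)
qed

subsection \<open>Orthogonal series\<close>

text \<open>No normalisation and no exclusion of zero vectors: the squares
  \<open>(X j)^2 - 1\<close> have merely bounded norms, and a multiple of \<open>X j\<close> by its
  third moment may vanish.\<close>

definition L2_orthogonal_on :: "'a measure \<Rightarrow> 'i set \<Rightarrow> ('i \<Rightarrow> 'a \<Rightarrow> real) \<Rightarrow> bool" where
  "L2_orthogonal_on M J Y \<longleftrightarrow> (\<forall>i\<in>J. Y i \<in> L2_space M) \<and>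
     (\<forall>i\<in>J. \<forall>j\<in>J. i \<noteq> j \<longrightarrow> L2_inner M (Y i) (Y j) = 0)"

definition L2_orthonormal_on :: "'a measure \<Rightarrow> 'i set \<Rightarrow> ('i \<Rightarrow> 'a \<Rightarrow> real) \<Rightarrow> bool" where
  "L2_orthonormal_on M J Y \<longleftrightarrow> L2_orthogonal_on M J Y \<and> (\<forall>i\<in>J. L2_inner M (Y i) (Y i) = 1)"

lemma L2_orthogonal_on_subset: "L2_orthogonal_on M I Y \<Longrightarrow> J \<subseteq> I \<Longrightarrow> L2_orthogonal_on M J Y"
  by (simp add: L2_orthogonal_on_def subset_iff)

lemma L2_orthonormal_on_subset: "L2_orthonormal_on M I Y \<Longrightarrow> J \<subseteq> I \<Longrightarrow> L2_orthonormal_on M J Y"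
  by (simp add: L2_orthonormal_on_def L2_orthogonal_on_def subset_iff)

lemma L2_inner_combination:
  assumes "L2_orthogonal_on M J Y" "f \<in> L2_space M"
  shows "L2_inner M f (\<lambda>x. \<Sum>i\<in>J. c i * Y i x) = (\<Sum>i\<in>J. c i * L2_inner M f (Y i))"
proof -
  have "L2_inner M (\<lambda>x. \<Sum>i\<in>J. c i * Y i x) f = (\<Sum>i\<in>J. L2_inner M (\<lambda>x. c i * Y i x) f)"
    using assms by (intro L2_inner_sum_left L2_space_cmult) (auto simp: L2_orthogonal_on_def)
  then show ?thesis
    by (simp add: L2_inner_cmult_left L2_inner_commute[of M f])
qed

lemma L2_space_combination:
  "L2_orthogonal_on M J Y \<Longrightarrow> (\<lambda>x. \<Sum>i\<in>J. c i * Y i x) \<in> L2_space M"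
  by (intro L2_space_sum L2_space_cmult) (simp add: L2_orthogonal_on_def)

lemma L2_inner_combination_self:
  assumes Y: "L2_orthogonal_on M J Y" and "finite J"
  shows "L2_inner M (\<lambda>x. \<Sum>i\<in>J. c i * Y i x) (\<lambda>x. \<Sum>i\<in>J. c i * Y i x)
    = (\<Sum>i\<in>J. (c i)\<^sup>2 * L2_inner M (Y i) (Y i))"
proof -
  have "L2_inner M (\<lambda>x. \<Sum>i\<in>J. c i * Y i x) (Y j) = c j * L2_inner M (Y j) (Y j)" if "j \<in> J" for j
  proof -
    have "L2_inner M (\<lambda>x. \<Sum>i\<in>J. c i * Y i x) (Y j) = (\<Sum>i\<in>J. c i * L2_inner M (Y j) (Y i))"
      using L2_inner_combination[OF Y, of "Y j" c] Y that
      by (simp add: L2_inner_commute[of M _ "Y j"] L2_orthogonal_on_def)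
    also have "\<dots> = (\<Sum>i\<in>J. if i = j then c j * L2_inner M (Y j) (Y j) else 0)"
      using Y that by (intro sum.cong) (auto simp: L2_orthogonal_on_def)
    finally show ?thesis using \<open>finite J\<close> that by simp
  qed
  then show ?thesis
    by (simp add: L2_inner_combination[OF Y L2_space_combination[OF Y]] power2_eq_square mult.assoc)
qed

text \<open>Completing the square in the coefficients \<open>d\<close>. The last sum vanishes
  exactly for the Fourier coefficients, which gives both Bessel's inequality and the best
  approximation property.\<close>

lemma L2_inner_diff_combination_self:
  assumes \<psi>: "L2_orthonormal_on M J \<psi>" and "finite J" and f: "f \<in> L2_space M"
  shows "L2_inner M (\<lambda>x. f x - (\<Sum>i\<in>J. d i * \<psi> i x)) (\<lambda>x. f x - (\<Sum>i\<in>J. d i * \<psi> i x))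
    = L2_inner M f f - (\<Sum>i\<in>J. (L2_inner M f (\<psi> i))\<^sup>2) + (\<Sum>i\<in>J. (d i - L2_inner M f (\<psi> i))\<^sup>2)"
proof -
  have o: "L2_orthogonal_on M J \<psi>" using \<psi> by (simp add: L2_orthonormal_on_def)
  have "L2_inner M (\<lambda>x. f x - (\<Sum>i\<in>J. d i * \<psi> i x)) (\<lambda>x. f x - (\<Sum>i\<in>J. d i * \<psi> i x))
      = L2_inner M f f - 2 * (\<Sum>i\<in>J. d i * L2_inner M f (\<psi> i)) + (\<Sum>i\<in>J. (d i)\<^sup>2)"
    using L2_inner_add_cmult_self[OF f L2_space_combination[OF o, of d], of "-1"] \<psi>
    by (simp add: L2_inner_combination[OF o f] L2_inner_combination_self[OF o \<open>finite J\<close>]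
        L2_orthonormal_on_def)
  also have "\<dots> = L2_inner M f f - (\<Sum>i\<in>J. (L2_inner M f (\<psi> i))\<^sup>2)
      + (\<Sum>i\<in>J. (d i - L2_inner M f (\<psi> i))\<^sup>2)"
    by (simp add: power2_diff sum.distrib sum_subtractf sum_distrib_left mult.assoc)
  finally show ?thesis .
qed

lemma L2_Bessel:
  assumes "L2_orthonormal_on M J \<psi>" "finite J" "f \<in> L2_space M"
  shows "(\<Sum>i\<in>J. (L2_inner M f (\<psi> i))\<^sup>2) \<le> L2_inner M f f"
  using L2_inner_diff_combination_self[OF assms, of "\<lambda>i. L2_inner M f (\<psi> i)"]
    L2_inner_self_nonneg[of M "\<lambda>x. f x - (\<Sum>i\<in>J. L2_inner M f (\<psi> i) * \<psi> i x)"]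
  by simp

section \<open>Expansion in a Hilbert basis\<close>

lemma hilbert_basis_orthonormal: "hilbert_basis M e \<Longrightarrow> L2_orthonormal_on M {1..} e"
  by (auto simp: hilbert_basis_def L2_orthonormal_on_def L2_orthogonal_on_def)

text \<open>Density supplies some finite combination close to \<open>f\<close>; every Fourier
  partial sum that is at least as long is at least as close.\<close>

lemma hilbert_basis_expansion:
  assumes e: "hilbert_basis M e" and f: "f \<in> L2_space M"
  shows "L2_tendsto M (\<lambda>n x. \<Sum>j=1..n. L2_inner M f (e j) * e j x) f"
proof -
  have on: "L2_orthonormal_on M {1..n} e" for n
    by (rule L2_orthonormal_on_subset[OF hilbert_basis_orthonormal[OF e]]) auto
  then have o: "L2_orthogonal_on M {1..n} e" for n by (simp add: L2_orthonormal_on_def)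
  define p where "p n x = (\<Sum>j=1..n. L2_inner M f (e j) * e j x)" for n x
  have best: "L2_norm M (\<lambda>x. f x - p n x) \<le> L2_norm M (\<lambda>x. f x - (\<Sum>j=1..m. c j * e j x))"
    if "m \<le> n" for m n c
  proof -
    \<comment> \<open>A combination of length \<open>m\<close> is padded with zero coefficients up
      to length \<open>n\<close>, so that both approximations live on the same orthonormal
      family.\<close>
    define d where "d j = (if j \<le> m then c j else 0)" for j
    have "(\<Sum>j=1..n. d j * e j x) = (\<Sum>j=1..m. c j * e j x)" for x
      using that by (intro sum.mono_neutral_cong_right) (auto simp: d_def)
    moreover have "0 \<le> (\<Sum>i\<in>{1..n}. (d i - L2_inner M f (e i))\<^sup>2)" by (simp add: sum_nonneg)
    ultimately show ?thesis
      using L2_inner_diff_combination_self[OF on[of n] _ f, of d]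
        L2_inner_diff_combination_self[OF on[of n] _ f, of "\<lambda>j. L2_inner M f (e j)"]
      unfolding L2_norm_def p_def by (intro real_sqrt_le_mono) simp
  qed
  have "(\<lambda>n. L2_norm M (\<lambda>x. p n x - f x)) \<longlonglongrightarrow> 0"
  proof (rule LIMSEQ_I)
    fix \<epsilon> :: real assume "0 < \<epsilon>"
    then obtain m c where "L2_norm M (\<lambda>x. f x - (\<Sum>j=1..m. c j * e j x)) < \<epsilon>"
      using e f unfolding hilbert_basis_def by blast
    then have "L2_norm M (\<lambda>x. p n x - f x) < \<epsilon>" if "n \<ge> m" for n
      using best[OF that, of c] by (simp add: L2_norm_diff_commute[of M "p n"])
    then show "\<exists>m. \<forall>n\<ge>m. norm (L2_norm M (\<lambda>x. p n x - f x) - 0) < \<epsilon>"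
      by (auto simp: L2_norm_nonneg)
  qed
  then show ?thesis
    using f L2_space_combination[OF o] by (simp add: L2_tendsto_def p_def)
qed

lemma L2_inner_tendsto_left:
  assumes u: "L2_tendsto M u f" and g: "g \<in> L2_space M"
  shows "(\<lambda>n. L2_inner M (u n) g) \<longlonglongrightarrow> L2_inner M f g"
proof (rule LIM_zero_cancel, rule Lim_null_comparison)
  note [simp] = u[unfolded L2_tendsto_def]
  show "(\<lambda>n. L2_norm M (\<lambda>x. u n x - f x) * L2_norm M g) \<longlonglongrightarrow> 0"
    by (simp add: tendsto_mult_left_zero)
  have "\<bar>L2_inner M (u n) g - L2_inner M f g\<bar> \<le> L2_norm M (\<lambda>x. u n x - f x) * L2_norm M g" for n
    using L2_inner_Cauchy_Schwarz[of "\<lambda>x. u n x - f x" M g] g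
    by (simp add: L2_space_diff L2_inner_diff_left)
  then show "\<forall>\<^sub>F n in sequentially. norm (L2_inner M (u n) g - L2_inner M f g)
      \<le> L2_norm M (\<lambda>x. u n x - f x) * L2_norm M g" by simp
qed

text \<open>The inner product with \<open>g\<close> is continuous and is applied to the expansion of
  \<open>f\<close>.\<close>

lemma hilbert_basis_Parseval:
  assumes e: "hilbert_basis M e" and f: "f \<in> L2_space M" and g: "g \<in> L2_space M"
  shows "(\<lambda>n. \<Sum>j=1..n. L2_inner M f (e j) * L2_inner M g (e j)) \<longlonglongrightarrow> L2_inner M f g"
proof -
  have o: "L2_orthogonal_on M {1..n} e" for n
    using L2_orthonormal_on_subset[OF hilbert_basis_orthonormal[OF e], of "{1..n}"]
    by (auto simp: L2_orthonormal_on_def)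
  show ?thesis
    using L2_inner_tendsto_left[OF hilbert_basis_expansion[OF e f] g]
    by (simp add: L2_inner_commute[of M _ g] L2_inner_combination[OF o g] del: One_nat_def)
qed

section \<open>Transfer of coefficients to a bounded orthogonal family\<close>

definition L2_transfer :: "'a measure \<Rightarrow> 'b measure \<Rightarrow> (nat \<Rightarrow> 'i set) \<Rightarrow> ('i \<Rightarrow> 'a \<Rightarrow> real) \<Rightarrow>
    ('i \<Rightarrow> 'b \<Rightarrow> real) \<Rightarrow> ('a \<Rightarrow> real) \<Rightarrow> 'b \<Rightarrow> real" where
  "L2_transfer M N A \<psi> Y f = L2_lim N (\<lambda>n \<omega>. \<Sum>i\<in>A n. L2_inner M f (\<psi> i) * Y i \<omega>)"

text \<open>
  All the maps of the theorem are of this kind: the coefficients with respect to an orthonormal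
  family are transferred to a bounded orthogonal family. The finite sets \<open>A n\<close> fix the order of
  summation.
\<close>

locale orthogonal_transfer = N: prob_space N
  for M :: "'a measure" and N :: "'b measure" and A :: "nat \<Rightarrow> 'i set"
    and \<psi> :: "'i \<Rightarrow> 'a \<Rightarrow> real" and Y :: "'i \<Rightarrow> 'b \<Rightarrow> real" and B :: real +
  assumes finite_A: "finite (A n)" and incseq_A: "incseq A"
    and \<psi>: "L2_orthonormal_on M (\<Union>n. A n) \<psi>"
    and Y: "L2_orthogonal_on N (\<Union>n. A n) Y"
    and Y_bound: "i \<in> (\<Union>n. A n) \<Longrightarrow> L2_inner N (Y i) (Y i) \<le> B"
    and B_nonneg: "0 \<le> B"
begin

abbreviation partial :: "('a \<Rightarrow> real) \<Rightarrow> nat \<Rightarrow> 'b \<Rightarrow> real" where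
  "partial f \<equiv> \<lambda>n \<omega>. \<Sum>i\<in>A n. L2_inner M f (\<psi> i) * Y i \<omega>"

abbreviation "T \<equiv> L2_transfer M N A \<psi> Y"

lemma orthogonal_subset: "J \<subseteq> A n \<Longrightarrow> L2_orthogonal_on N J Y"
  by (rule L2_orthogonal_on_subset[OF Y]) blast

lemma partial_L2: "partial f n \<in> L2_space N"
  by (rule L2_space_combination[OF orthogonal_subset[OF order_refl]])

text \<open>Pythagoras and the uniform bound \<open>B\<close>. The index set is an arbitrary part of
  \<open>A n\<close> because the estimate also serves for the increments
  \<open>A n - A m\<close>.\<close>

lemma norm_combination_le:
  assumes "J \<subseteq> A n"
  shows "L2_inner N (\<lambda>\<omega>. \<Sum>i\<in>J. c i * Y i \<omega>) (\<lambda>\<omega>. \<Sum>i\<in>J. c i * Y i \<omega>) \<le> B * (\<Sum>i\<in>J. (c i)\<^sup>2)"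
proof -
  have "finite J" using assms finite_A by (rule finite_subset)
  then have "L2_inner N (\<lambda>\<omega>. \<Sum>i\<in>J. c i * Y i \<omega>) (\<lambda>\<omega>. \<Sum>i\<in>J. c i * Y i \<omega>)
      = (\<Sum>i\<in>J. (c i)\<^sup>2 * L2_inner N (Y i) (Y i))"
    by (intro L2_inner_combination_self orthogonal_subset[OF assms])
  also have "\<dots> \<le> (\<Sum>i\<in>J. (c i)\<^sup>2 * B)"
    using assms Y_bound by (intro sum_mono mult_left_mono) auto
  finally show ?thesis by (simp add: sum_distrib_left mult.commute)
qed

lemma Bessel: "f \<in> L2_space M \<Longrightarrow> (\<Sum>i\<in>A n. (L2_inner M f (\<psi> i))\<^sup>2) \<le> L2_inner M f f"
  by (intro L2_Bessel L2_orthonormal_on_subset[OF \<psi>] finite_A) auto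

text \<open>Pythagoras on the side of \<open>N\<close> and Bessel on the side of \<open>M\<close>;
  the bound does not depend on \<open>n\<close> and so passes to the limit.\<close>

lemma norm_partial_le:
  assumes "f \<in> L2_space M"
  shows "L2_norm N (partial f n) \<le> L2_norm M f * sqrt B"
proof -
  have "L2_inner N (partial f n) (partial f n) \<le> B * L2_inner M f f"
    using norm_combination_le[of "A n" n "\<lambda>i. L2_inner M f (\<psi> i)"]
      mult_left_mono[OF Bessel[OF assms, of n] B_nonneg] by simp
  then have "L2_norm N (partial f n) \<le> sqrt (B * L2_inner M f f)"
    unfolding L2_norm_def by (rule real_sqrt_le_mono)
  then show ?thesis by (simp add: L2_norm_def[of M f] real_sqrt_mult mult.commute)
qed

text \<open>The sums of squared coefficients increase and are bounded by Bessel, hence are Cauchy.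
  Up to the factor \<open>B\<close> they control the squared distances of the partial sums, and
  completeness gives the limit.\<close>

lemma tendsto:
  assumes f: "f \<in> L2_space M"
  shows "L2_tendsto N (partial f) (T f)"
proof -
  define s where "s n = (\<Sum>i\<in>A n. (L2_inner M f (\<psi> i))\<^sup>2)" for n
  have mono: "s m \<le> s n" if "m \<le> n" for m n
    unfolding s_def using incseqD[OF incseq_A that] finite_A by (intro sum_mono2) auto
  have "convergent s"
    using Bessel[OF f] mono unfolding s_def[symmetric]
    by (intro Bseq_mono_convergent BseqI'[of s "L2_inner M f f"]) (auto simp: s_def sum_nonneg)
  then have "Cauchy s" by (rule convergent_Cauchy)
  have step: "(L2_norm N (\<lambda>\<omega>. partial f n \<omega> - partial f m \<omega>))\<^sup>2 \<le> B * \<bar>s n - s m\<bar>"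
    if "m \<le> n" for m n
  proof -
    have "partial f n \<omega> - partial f m \<omega> = (\<Sum>i\<in>A n - A m. L2_inner M f (\<psi> i) * Y i \<omega>)" for \<omega>
      using incseqD[OF incseq_A that] finite_A by (simp add: sum_diff)
    moreover have "s n - s m = (\<Sum>i\<in>A n - A m. (L2_inner M f (\<psi> i))\<^sup>2)"
      using incseqD[OF incseq_A that] finite_A by (simp add: sum_diff s_def)
    ultimately show ?thesis
      using norm_combination_le[of "A n - A m" n "\<lambda>i. L2_inner M f (\<psi> i)"] mono[OF that]
      by (simp add: L2_norm_sq)
  qed
  have step: "(L2_norm N (\<lambda>\<omega>. partial f m \<omega> - partial f n \<omega>))\<^sup>2 \<le> B * \<bar>s m - s n\<bar>" for m n
  proof (cases "m \<le> n")
    case True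
    then show ?thesis
      using step[OF True] by (simp add: L2_norm_diff_commute[of N "partial f m"] abs_minus_commute)
  next
    case False
    then show ?thesis using step[of n m] by simp
  qed
  obtain g where "L2_tendsto N (partial f) g"
  proof (rule N.L2_complete)
    show "partial f n \<in> L2_space N" for n by (rule partial_L2)
    fix \<epsilon> :: real assume "0 < \<epsilon>"
    \<comment> \<open>Dividing by \<open>B + 1\<close> covers the case \<open>B = 0\<close> and
      leaves a strict inequality after multiplication by \<open>B\<close>.\<close>
    then have "0 < \<epsilon>\<^sup>2 / (B + 1)" using B_nonneg by simp
    with \<open>Cauchy s\<close> obtain n0 where n0: "\<bar>s m - s n\<bar> < \<epsilon>\<^sup>2 / (B + 1)" if "m \<ge> n0" "n \<ge> n0" for m n
      unfolding Cauchy_def dist_real_def by metis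
    have "L2_norm N (\<lambda>\<omega>. partial f m \<omega> - partial f n \<omega>) < \<epsilon>" if "m \<ge> n0" "n \<ge> n0" for m n
    proof (rule power2_less_imp_less)
      have "B * \<bar>s m - s n\<bar> \<le> B * (\<epsilon>\<^sup>2 / (B + 1))"
        using n0[OF that] B_nonneg by (intro mult_left_mono) auto
      also have "\<dots> < \<epsilon>\<^sup>2" using \<open>0 < \<epsilon>\<close> B_nonneg by (simp add: field_simps)
      finally show "(L2_norm N (\<lambda>\<omega>. partial f m \<omega> - partial f n \<omega>))\<^sup>2 < \<epsilon>\<^sup>2"
        using step[of m n] by simp
    qed (use \<open>0 < \<epsilon>\<close> in simp)
    then show "\<exists>n0. \<forall>m\<ge>n0. \<forall>n\<ge>n0. L2_norm N (\<lambda>\<omega>. partial f m \<omega> - partial f n \<omega>) < \<epsilon>"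
      by blast
  qed
  then show ?thesis unfolding L2_transfer_def by (rule L2_lim_tendsto)
qed

lemma T_L2: "f \<in> L2_space M \<Longrightarrow> T f \<in> L2_space N"
  using tendsto by (simp add: L2_tendsto_def)

lemma norm_T_le:
  assumes "f \<in> L2_space M"
  shows "L2_norm N (T f) \<le> L2_norm M f * sqrt B"
  by (rule LIMSEQ_le_const2[OF L2_tendsto_norm[OF tendsto[OF assms]]])
    (auto simp: norm_partial_le[OF assms])

text \<open>Each value of \<open>T\<close> is a chosen limit, so linearity can hold only almost
  everywhere: both sides are limits of the same partial sums.\<close>

lemma T_linear:
  assumes f: "f \<in> L2_space M" and g: "g \<in> L2_space M"
  shows "L2_eq N (T (\<lambda>x. a * f x + b * g x)) (\<lambda>\<omega>. a * T f \<omega> + b * T g \<omega>)"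
proof (rule L2_tendsto_unique)
  show "L2_tendsto N (partial (\<lambda>x. a * f x + b * g x)) (T (\<lambda>x. a * f x + b * g x))"
    by (intro tendsto L2_space_add L2_space_cmult f g)
  have "partial (\<lambda>x. a * f x + b * g x) n \<omega> = a * partial f n \<omega> + b * partial g n \<omega>" for n \<omega>
  proof -
    have "L2_inner M (\<lambda>x. a * f x + b * g x) (\<psi> i) = a * L2_inner M f (\<psi> i) + b * L2_inner M g (\<psi> i)"
      if "i \<in> A n" for i
      using \<psi> that f g unfolding L2_orthonormal_on_def L2_orthogonal_on_def
      by (subst L2_inner_add_left) (auto intro: L2_space_cmult simp: L2_inner_cmult_left)
    then show ?thesis by (simp add: ring_distribs sum.distrib sum_distrib_left mult.assoc)
  qed
  then show "L2_tendsto N (partial (\<lambda>x. a * f x + b * g x)) (\<lambda>\<omega>. a * T f \<omega> + b * T g \<omega>)"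
    using L2_tendsto_add[OF L2_tendsto_cmult[OF tendsto[OF f], of a]
        L2_tendsto_cmult[OF tendsto[OF g], of b]] by simp
qed

lemma cont_linear: "V \<subseteq> L2_space M \<Longrightarrow> cont_linear_L2 M V N T"
  unfolding cont_linear_L2_def using T_L2 T_linear norm_T_le by (meson subsetD)

text \<open>As soon as \<open>A n\<close> contains \<open>i\<close>, the partial sums are constantly
  \<open>c * Y i\<close>. This computes the transfers on symmetrized basis tensors.\<close>

lemma T_eq_single:
  assumes f: "f \<in> L2_space M" and i: "i \<in> (\<Union>n. A n)"
    and coeff: "\<And>j. j \<in> (\<Union>n. A n) \<Longrightarrow> L2_inner M f (\<psi> j) = (if j = i then c else 0)"
  shows "L2_eq N (T f) (\<lambda>\<omega>. c * Y i \<omega>)"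
proof -
  obtain n0 where n0: "i \<in> A n0" using i by blast
  have *: "partial f n = (\<lambda>\<omega>. c * Y i \<omega>)" if "n \<ge> n0" for n
  proof
    fix \<omega>
    have "partial f n \<omega> = (\<Sum>j\<in>A n. if j = i then c * Y i \<omega> else 0)"
      by (intro sum.cong refl) (subst coeff, auto)
    also have "\<dots> = c * Y i \<omega>"
      using finite_A incseqD[OF incseq_A that] n0 by auto
    finally show "partial f n \<omega> = c * Y i \<omega>" .
  qed
  \<comment> \<open>The sequence is shifted by \<open>n0\<close>, after which every term equals
    \<open>c * Y i\<close>.\<close>
  have lim: "L2_tendsto N (\<lambda>n. partial f (n + n0)) (T f)"
    using tendsto[OF f] unfolding L2_tendsto_def
    by (auto intro: LIMSEQ_ignore_initial_segment[where k = n0, of "\<lambda>n. L2_norm N (\<lambda>\<omega>. partial f n \<omega> - T f \<omega>)"])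
  have "(\<lambda>\<omega>. c * Y i \<omega>) \<in> L2_space N"
    using partial_L2[of f n0] *[of n0] by simp
  then show ?thesis
    using lim L2_tendsto_unique L2_tendsto_const by (simp add: *) blast
qed

lemma T_eq_zero:
  assumes f: "f \<in> L2_space M" and coeff: "\<And>j. j \<in> (\<Union>n. A n) \<Longrightarrow> L2_inner M f (\<psi> j) = 0"
  shows "L2_eq N (T f) (\<lambda>\<omega>. 0)"
proof (rule L2_tendsto_unique[OF tendsto[OF f]])
  have "partial f n = (\<lambda>\<omega>. 0)" for n
    using coeff by (force intro: sum.neutral)
  then show "L2_tendsto N (partial f) (\<lambda>\<omega>. 0)"
    using L2_tendsto_const[OF L2_space_zero] by simp
qed

end

subsection \<open>Tensor products\<close>

lemma (in sigma_finite_measure) integral_tensor: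
  fixes f g :: "'a \<Rightarrow> real"
  assumes f: "integrable M f" and g: "integrable M g"
  shows integrable_tensor: "integrable (M \<Otimes>\<^sub>M M) (\<lambda>(x, y). f x * g y)"
    and "(\<integral>p. (case p of (x, y) \<Rightarrow> f x * g y) \<partial>(M \<Otimes>\<^sub>M M)) = (\<integral>x. f x \<partial>M) * (\<integral>y. g y \<partial>M)"
proof -
  interpret pair_sigma_finite M M ..
  have [measurable]: "f \<in> borel_measurable M" "g \<in> borel_measurable M"
    using f g by auto
  show int: "integrable (M \<Otimes>\<^sub>M M) (\<lambda>(x, y). f x * g y)"
    using f g by (intro Fubini_integrable) (simp_all add: abs_mult)
  show "(\<integral>p. (case p of (x, y) \<Rightarrow> f x * g y) \<partial>(M \<Otimes>\<^sub>M M)) = (\<integral>x. f x \<partial>M) * (\<integral>y. g y \<partial>M)"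
    using integral_fst'[OF int] by simp
qed

lemma tensor_measurable:
  assumes [measurable]: "f \<in> borel_measurable M" "g \<in> borel_measurable M"
  shows "f \<otimes>\<^sub>f g \<in> borel_measurable (M \<Otimes>\<^sub>M M)"
  unfolding tensor_def by measurable

lemma (in sigma_finite_measure) L2_space_tensor:
  assumes "f \<in> L2_space M" "g \<in> L2_space M"
  shows "f \<otimes>\<^sub>f g \<in> L2_space (M \<Otimes>\<^sub>M M)"
proof -
  have "(\<lambda>p. ((f \<otimes>\<^sub>f g) p)\<^sup>2) = (\<lambda>(x, y). (f x)\<^sup>2 * (g y)\<^sup>2)"
    by (auto simp: tensor_def power_mult_distrib)
  then show ?thesis
    using integrable_tensor[OF assms[THEN L2_spaceD(2)]] tensor_measurable assms[THEN L2_spaceD(1)]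
    by (simp add: L2_space_def)
qed

lemma (in sigma_finite_measure) L2_inner_tensor:
  assumes "f \<in> L2_space M" "g \<in> L2_space M" "f' \<in> L2_space M" "g' \<in> L2_space M"
  shows "L2_inner (M \<Otimes>\<^sub>M M) (f \<otimes>\<^sub>f g) (f' \<otimes>\<^sub>f g') = L2_inner M f f' * L2_inner M g g'"
proof -
  have "(\<lambda>p. (f \<otimes>\<^sub>f g) p * (f' \<otimes>\<^sub>f g') p) = (\<lambda>(x, y). (f x * f' x) * (g y * g' y))"
    by (auto simp: tensor_def)
  then show ?thesis
    using integral_tensor(2)[of "\<lambda>x. f x * f' x" "\<lambda>x. g x * g' x"] assms
    by (simp add: L2_inner_def L2_space_mult_integrable)
qed

lemma (in sigma_finite_measure) L2_space_swap:
  assumes F: "F \<in> L2_space (M \<Otimes>\<^sub>M M)"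
  shows "(\<lambda>(x, y). F (y, x)) \<in> L2_space (M \<Otimes>\<^sub>M M)"
proof -
  interpret pair_sigma_finite M M ..
  have [measurable]: "F \<in> borel_measurable (M \<Otimes>\<^sub>M M)"
    using F by (rule L2_spaceD)
  have "integrable (M \<Otimes>\<^sub>M M) (\<lambda>(x, y). (F (y, x))\<^sup>2)"
    using integrable_product_swap[OF L2_spaceD(2)[OF F]] by simp
  moreover have "(\<lambda>p. (case p of (x, y) \<Rightarrow> F (y, x))\<^sup>2) = (\<lambda>(x, y). (F (y, x))\<^sup>2)"
    by auto
  moreover have "(\<lambda>(x, y). F (y, x)) \<in> borel_measurable (M \<Otimes>\<^sub>M M)" by measurable
  ultimately show ?thesis by (simp add: L2_space_def)
qed

text \<open>The product measure is invariant under exchange of the coordinates, so the exchange can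
  be moved from \<open>F\<close> to the tensor.\<close>

lemma (in sigma_finite_measure) L2_inner_swap_tensor:
  assumes F: "F \<in> L2_space (M \<Otimes>\<^sub>M M)" and "a \<in> L2_space M" "b \<in> L2_space M"
  shows "L2_inner (M \<Otimes>\<^sub>M M) (\<lambda>(x, y). F (y, x)) (a \<otimes>\<^sub>f b) = L2_inner (M \<Otimes>\<^sub>M M) F (b \<otimes>\<^sub>f a)"
proof -
  note ba = L2_space_tensor[OF assms(3,2)]
  interpret pair_sigma_finite M M ..
  have "(\<lambda>p. F p * (b \<otimes>\<^sub>f a) p) \<in> borel_measurable (M \<Otimes>\<^sub>M M)"
    by (rule borel_measurable_times[OF L2_spaceD(1)[OF F] L2_spaceD(1)[OF ba]])
  then have "(\<integral>(x, y). F (y, x) * (b \<otimes>\<^sub>f a) (y, x) \<partial>(M \<Otimes>\<^sub>M M)) = (\<integral>p. F p * (b \<otimes>\<^sub>f a) p \<partial>(M \<Otimes>\<^sub>M M))"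
    using integral_product_swap[of "\<lambda>p. F p * (b \<otimes>\<^sub>f a) p"] by simp
  moreover have "(\<lambda>p. (case p of (x, y) \<Rightarrow> F (y, x)) * (a \<otimes>\<^sub>f b) p)
      = (\<lambda>(x, y). F (y, x) * (b \<otimes>\<^sub>f a) (y, x))"
    by (auto simp: tensor_def)
  ultimately show ?thesis by (simp add: L2_inner_def)
qed

lemma symmetrize_eq: "symmetrize F = (\<lambda>p. (1/2) * (F p + (case p of (x, y) \<Rightarrow> F (y, x))))"
  by (auto simp: symmetrize_def)

lemma (in sigma_finite_measure) L2_space_symmetrize:
  "F \<in> L2_space (M \<Otimes>\<^sub>M M) \<Longrightarrow> symmetrize F \<in> L2_space (M \<Otimes>\<^sub>M M)"
  unfolding symmetrize_eq by (intro L2_space_cmult L2_space_add L2_space_swap)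

lemma (in sigma_finite_measure) symmetrize_in_L2_sym:
  "F \<in> L2_space (M \<Otimes>\<^sub>M M) \<Longrightarrow> symmetrize F \<in> L2_sym M"
  by (simp add: L2_sym_def L2_space_symmetrize) (simp add: symmetrize_def add.commute)

lemma (in sigma_finite_measure) L2_inner_symmetrize_tensor:
  assumes "F \<in> L2_space (M \<Otimes>\<^sub>M M)" and "a \<in> L2_space M" "b \<in> L2_space M"
  shows "L2_inner (M \<Otimes>\<^sub>M M) (symmetrize F) (a \<otimes>\<^sub>f b)
    = (L2_inner (M \<Otimes>\<^sub>M M) F (a \<otimes>\<^sub>f b) + L2_inner (M \<Otimes>\<^sub>M M) F (b \<otimes>\<^sub>f a)) / 2"
  using assms unfolding symmetrize_eq L2_inner_cmult_left
  by (subst L2_inner_add_left) (simp_all add: L2_space_swap L2_space_tensor L2_inner_swap_tensor)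

subsection \<open>Mixed moments\<close>

text \<open>Collecting equal indices turns a monomial with repetitions into a product of powers over
  distinct indices, the form in which independence applies.\<close>

lemma prod_list_eq_prod_power:
  fixes f :: "'i \<Rightarrow> 'a::comm_monoid_mult"
  assumes "finite J" "set is \<subseteq> J"
  shows "prod_list (map f is) = (\<Prod>i\<in>J. f i ^ count_list is i)"
  using assms(2)
proof (induction "is")
  case (Cons a "is")
  have "(\<Prod>i\<in>J. f i ^ count_list (a # is) i)
      = (\<Prod>i\<in>J. (if i = a then f a else 1) * f i ^ count_list is i)"
    by (intro prod.cong) auto
  also have "\<dots> = f a * (\<Prod>i\<in>J. f i ^ count_list is i)"
    using Cons.prems \<open>finite J\<close> by (simp add: prod.distrib)
  finally show ?case using Cons by simp
qed simp

text \<open>The moment hypothesis enters through order four: \<open>K\<close> bounds the squared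
  norms of \<open>(X j)^2 - 1\<close> and the squares of the third moments.\<close>

locale moment_sequence = prob_space N for N :: "'e measure" +
  fixes X :: "nat \<Rightarrow> 'e \<Rightarrow> real" and K :: real
  assumes indep: "indep_vars (\<lambda>_. borel) X {1..}"
    and mean: "k \<ge> 1 \<Longrightarrow> expectation (X k) = 0"
    and second_moment: "k \<ge> 1 \<Longrightarrow> expectation (\<lambda>\<omega>. (X k \<omega>)\<^sup>2) = 1"
    and integrable_fourth: "k \<ge> 1 \<Longrightarrow> integrable N (\<lambda>\<omega>. (X k \<omega>) ^ 4)"
    and fourth_moment_le: "k \<ge> 1 \<Longrightarrow> expectation (\<lambda>\<omega>. (X k \<omega>) ^ 4) \<le> K"
begin

lemma X_measurable: "k \<ge> 1 \<Longrightarrow> X k \<in> borel_measurable N"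
  using indep by (simp add: indep_vars_def)

lemma K_nonneg: "0 \<le> K"
proof -
  have "0 \<le> expectation (\<lambda>\<omega>. (X 1 \<omega>) ^ 4)" by simp
  then show ?thesis by (rule order_trans[OF _ fourth_moment_le]) simp
qed

lemma integrable_power:
  assumes "k \<ge> 1" "m \<le> 4"
  shows "integrable N (\<lambda>\<omega>. (X k \<omega>) ^ m)"
proof (rule Bochner_Integration.integrable_bound)
  show "integrable N (\<lambda>\<omega>. 1 + (X k \<omega>) ^ 4)"
    using integrable_fourth[OF assms(1)] by simp
  show "(\<lambda>\<omega>. (X k \<omega>) ^ m) \<in> borel_measurable N"
    using X_measurable[OF assms(1)] by measurable
  have "\<bar>x ^ m\<bar> \<le> 1 + x ^ 4" for x :: real
  proof (cases "\<bar>x\<bar> \<le> 1")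
    case True
    then have "\<bar>x\<bar> ^ m \<le> 1" by (simp add: power_le_one)
    moreover have "0 \<le> x ^ 4" by simp
    ultimately show ?thesis unfolding power_abs by linarith
  next
    case False
    then have "\<bar>x\<bar> ^ m \<le> \<bar>x\<bar> ^ 4" using assms(2) by (intro power_increasing) auto
    then show ?thesis by (simp add: power_abs)
  qed
  then show "AE \<omega> in N. norm ((X k \<omega>) ^ m) \<le> norm (1 + (X k \<omega>) ^ 4)" by simp
qed

text \<open>Independence factorizes the monomial after equal indices are collected. At most four
  factors means exponents at most four, hence integrable powers.\<close>

lemma mixed_moment:
  assumes "set is \<subseteq> {1..}" "length is \<le> 4"
  shows integrable_mixed: "integrable N (\<lambda>\<omega>. prod_list (map (\<lambda>i. X i \<omega>) is))"
    and "expectation (\<lambda>\<omega>. prod_list (map (\<lambda>i. X i \<omega>) is))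
      = (\<Prod>i\<in>set is. expectation (\<lambda>\<omega>. (X i \<omega>) ^ count_list is i))"
proof -
  have eq: "prod_list (map (\<lambda>i. X i \<omega>) is) = (\<Prod>i\<in>set is. (X i \<omega>) ^ count_list is i)" for \<omega>
    by (rule prod_list_eq_prod_power) auto
  have ind: "indep_vars (\<lambda>_. borel) (\<lambda>i \<omega>. (X i \<omega>) ^ count_list is i) (set is)"
    by (rule indep_vars_compose2[OF indep_vars_subset[OF indep assms(1)]]) simp
  have int: "integrable N (\<lambda>\<omega>. (X i \<omega>) ^ count_list is i)" if "i \<in> set is" for i
    using that assms count_le_length[of "is" i] by (intro integrable_power) auto
  show "integrable N (\<lambda>\<omega>. prod_list (map (\<lambda>i. X i \<omega>) is))"
    unfolding eq by (rule indep_vars_integrable[OF _ ind int]) auto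
  show "expectation (\<lambda>\<omega>. prod_list (map (\<lambda>i. X i \<omega>) is))
      = (\<Prod>i\<in>set is. expectation (\<lambda>\<omega>. (X i \<omega>) ^ count_list is i))"
    unfolding eq by (rule indep_vars_lebesgue_integral[OF _ ind int]) auto
qed

text \<open>An index occurring exactly once contributes the factor
  \<open>expectation (X i) = 0\<close>. The orthogonality of the \<open>X j\<close> and that of the
  products \<open>X k * X j\<close> come from here.\<close>

lemma mixed_moment_zero:
  assumes "set is \<subseteq> {1..}" "length is \<le> 4" "count_list is i = 1"
  shows "expectation (\<lambda>\<omega>. prod_list (map (\<lambda>i. X i \<omega>) is)) = 0"
proof -
  have "i \<in> set is" using assms(3) count_list_0_iff[of "is" i] by auto
  moreover have "expectation (\<lambda>\<omega>. (X i \<omega>) ^ count_list is i) = 0"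
    using assms mean \<open>i \<in> set is\<close> by auto
  ultimately show ?thesis
    unfolding mixed_moment(2)[OF assms(1,2)] by (auto intro: prod_zero)
qed

lemma X_L2: "k \<ge> 1 \<Longrightarrow> X k \<in> L2_space N"
  using integrable_power[of k 2] X_measurable by (simp add: L2_space_def)

lemma X_orthonormal: "L2_orthonormal_on N {1..} X"
proof -
  have "expectation (\<lambda>\<omega>. X i \<omega> * X j \<omega>) = 0" if "i \<ge> 1" "j \<ge> 1" "i \<noteq> j" for i j
    using mixed_moment_zero[of "[i, j]" i] that by simp
  then show ?thesis
    using second_moment X_L2
    by (auto simp: L2_orthonormal_on_def L2_orthogonal_on_def L2_inner_def power2_eq_square)
qed

lemma X_sq_L2: "k \<ge> 1 \<Longrightarrow> (\<lambda>\<omega>. (X k \<omega>)\<^sup>2) \<in> L2_space N"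
  using integrable_power[of k 4] X_measurable by (simp add: L2_space_def flip: power_mult)

lemma X_sq_minus_one_L2: "k \<ge> 1 \<Longrightarrow> (\<lambda>\<omega>. (X k \<omega>)\<^sup>2 - 1) \<in> L2_space N"
  by (intro L2_space_diff X_sq_L2 L2_space_const)

lemma X_sq_mult_moment:
  assumes "i \<ge> 1" "j \<ge> 1" "i \<noteq> j"
  shows "integrable N (\<lambda>\<omega>. (X i \<omega>)\<^sup>2 * (X j \<omega>)\<^sup>2)"
    and "expectation (\<lambda>\<omega>. (X i \<omega>)\<^sup>2 * (X j \<omega>)\<^sup>2) = 1"
  using mixed_moment[of "[i, i, j, j]"] assms second_moment
  by (simp_all add: power2_eq_square mult.assoc numeral_2_eq_2)

text \<open>Expanding the product, the four expectations are 1, -1, -1 and 1.\<close>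

lemma X_sq_minus_one_orthogonal: "L2_orthogonal_on N {1..} (\<lambda>j \<omega>. (X j \<omega>)\<^sup>2 - 1)"
proof -
  have "L2_inner N (\<lambda>\<omega>. (X i \<omega>)\<^sup>2 - 1) (\<lambda>\<omega>. (X j \<omega>)\<^sup>2 - 1) = 0"
    if "i \<ge> 1" "j \<ge> 1" "i \<noteq> j" for i j
  proof -
    have "L2_inner N (\<lambda>\<omega>. (X i \<omega>)\<^sup>2 - 1) (\<lambda>\<omega>. (X j \<omega>)\<^sup>2 - 1)
        = expectation (\<lambda>\<omega>. (X i \<omega>)\<^sup>2 * (X j \<omega>)\<^sup>2 - (X i \<omega>)\<^sup>2 - (X j \<omega>)\<^sup>2 + 1)"
      by (simp add: L2_inner_def algebra_simps)
    also have "\<dots> = 0"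
      using X_sq_mult_moment[OF that] integrable_power[of i 2] integrable_power[of j 2] that
      by (simp add: second_moment prob_space)
    finally show ?thesis .
  qed
  then show ?thesis by (simp add: L2_orthogonal_on_def X_sq_minus_one_L2)
qed

lemma X_sq_minus_one_bound:
  assumes "j \<ge> 1"
  shows "L2_inner N (\<lambda>\<omega>. (X j \<omega>)\<^sup>2 - 1) (\<lambda>\<omega>. (X j \<omega>)\<^sup>2 - 1) \<le> K"
proof -
  have "L2_inner N (\<lambda>\<omega>. (X j \<omega>)\<^sup>2 - 1) (\<lambda>\<omega>. (X j \<omega>)\<^sup>2 - 1)
      = expectation (\<lambda>\<omega>. (X j \<omega>) ^ 4 - 2 * (X j \<omega>)\<^sup>2 + 1)"
    unfolding L2_inner_def
    by (intro Bochner_Integration.integral_cong) (auto simp: power2_eq_square power4_eq_xxxx algebra_simps)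
  also have "\<dots> = expectation (\<lambda>\<omega>. (X j \<omega>) ^ 4) - 1"
    using integrable_power[of j 4] integrable_power[of j 2] assms by (simp add: second_moment prob_space)
  finally show ?thesis using fourth_moment_le[OF assms] by simp
qed

text \<open>This is the skewness of \<open>X j\<close> for \<open>j \<ge> 1\<close>, the variable
  being centered with variance one.\<close>

definition third_moment :: "nat \<Rightarrow> real" where
  "third_moment j = expectation (\<lambda>\<omega>. (X j \<omega>) ^ 3)"

text \<open>Cauchy-Schwarz for \<open>X j\<close> against its square, where \<open>X j\<close> has
  norm 1.\<close>

lemma third_moment_sq_le:
  assumes "j \<ge> 1"
  shows "(third_moment j)\<^sup>2 \<le> K"
proof -
  have "\<bar>L2_inner N (X j) (\<lambda>\<omega>. (X j \<omega>)\<^sup>2)\<bar> \<le> L2_norm N (X j) * L2_norm N (\<lambda>\<omega>. (X j \<omega>)\<^sup>2)"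
    using assms by (intro L2_inner_Cauchy_Schwarz X_L2 X_sq_L2)
  moreover have "L2_inner N (X j) (\<lambda>\<omega>. (X j \<omega>)\<^sup>2) = third_moment j"
    by (simp add: L2_inner_def third_moment_def power2_eq_square power3_eq_cube mult.assoc)
  moreover have "L2_norm N (X j) = 1"
    using second_moment[OF assms] by (simp add: L2_norm_def L2_inner_def power2_eq_square)
  ultimately have "\<bar>third_moment j\<bar>\<^sup>2 \<le> (L2_norm N (\<lambda>\<omega>. (X j \<omega>)\<^sup>2))\<^sup>2"
    by (intro power_mono) auto
  also have "\<dots> = expectation (\<lambda>\<omega>. (X j \<omega>) ^ 4)"
    by (simp add: L2_norm_sq L2_inner_def flip: power_add)
  finally show ?thesis using fourth_moment_le[OF assms] by simp
qed

text \<open>Used twice: with \<open>X\<close> for the linear correction inside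
  \<open>Phi_circ2\<close>, and with \<open>e\<close> for \<open>a12\<close>.\<close>

lemma scaled_third_orthogonal:
  assumes "L2_orthonormal_on M {1..} \<psi>"
  shows "L2_orthogonal_on M {1..} (\<lambda>j x. third_moment j * \<psi> j x)"
  using assms
  by (auto simp: L2_orthonormal_on_def L2_orthogonal_on_def L2_inner_cmult_left L2_inner_cmult_right
      intro: L2_space_cmult)

lemma scaled_third_bound:
  assumes "L2_orthonormal_on M {1..} \<psi>" "j \<ge> 1"
  shows "L2_inner M (\<lambda>x. third_moment j * \<psi> j x) (\<lambda>x. third_moment j * \<psi> j x) \<le> K"
  using assms third_moment_sq_le[OF assms(2)]
  by (auto simp: L2_orthonormal_on_def L2_inner_cmult_left L2_inner_cmult_right power2_eq_square)

text \<open>For two different pairs below the diagonal, some index occurs exactly once among the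
  four, so the mixed moment vanishes.\<close>

lemma X_mult_orthonormal: "L2_orthonormal_on N {(j, k). 1 \<le> k \<and> k < j} (\<lambda>(j, k) \<omega>. X k \<omega> * X j \<omega>)"
proof -
  have L2: "(\<lambda>\<omega>. X k \<omega> * X j \<omega>) \<in> L2_space N" and one: "L2_inner N (\<lambda>\<omega>. X k \<omega> * X j \<omega>) (\<lambda>\<omega>. X k \<omega> * X j \<omega>) = 1"
    if "1 \<le> k" "k < j" for j k
  proof -
    have eq: "(X k \<omega> * X j \<omega>) * (X k \<omega> * X j \<omega>) = (X k \<omega>)\<^sup>2 * (X j \<omega>)\<^sup>2" for \<omega>
      by (simp add: power2_eq_square)
    have "(\<lambda>\<omega>. X k \<omega> * X j \<omega>) \<in> borel_measurable N"
      using that by (intro borel_measurable_times X_measurable) auto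
    then show "(\<lambda>\<omega>. X k \<omega> * X j \<omega>) \<in> L2_space N"
      using X_sq_mult_moment(1)[of k j] that by (simp add: L2_space_def power_mult_distrib)
    show "L2_inner N (\<lambda>\<omega>. X k \<omega> * X j \<omega>) (\<lambda>\<omega>. X k \<omega> * X j \<omega>) = 1"
      using X_sq_mult_moment(2)[of k j] that by (simp add: L2_inner_def eq)
  qed
  have "L2_inner N (\<lambda>\<omega>. X k \<omega> * X j \<omega>) (\<lambda>\<omega>. X k' \<omega> * X j' \<omega>) = 0"
    if *: "1 \<le> k" "k < j" "1 \<le> k'" "k' < j'" and ne: "(j, k) \<noteq> (j', k')" for j k j' k'
  proof -
    have "\<exists>i. count_list [k, j, k', j'] i = 1"
    proof (cases "j = j'")
      case True
      \<comment> \<open>The larger indices agree, so the smaller ones differ and \<open>k\<close>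
        occurs once.\<close>
      with * ne show ?thesis by (intro exI[of _ k]) auto
    next
      case False
      \<comment> \<open>The larger of \<open>j\<close> and \<open>j'\<close> exceeds the other three
        indices.\<close>
      with * show ?thesis by (intro exI[of _ "max j j'"]) (auto simp: max_def)
    qed
    then obtain i where "count_list [k, j, k', j'] i = 1" by blast
    then have "expectation (\<lambda>\<omega>. prod_list (map (\<lambda>i. X i \<omega>) [k, j, k', j'])) = 0"
      using * by (intro mixed_moment_zero[of _ i]) auto
    then show ?thesis by (simp add: L2_inner_def mult.assoc)
  qed
  with L2 one show ?thesis
    by (auto simp: L2_orthonormal_on_def L2_orthogonal_on_def)
qed

end

subsection \<open>The maps of the theorem\<close>

text \<open>Serves to assemble a candidate for \<open>Phi_circ2\<close> from three coefficient
  transfers.\<close>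

lemma cont_linear_L2_combination:
  assumes S: "cont_linear_L2 M V N S" and T: "cont_linear_L2 M V N T"
  shows "cont_linear_L2 M V N (\<lambda>f \<omega>. a * S f \<omega> + b * T f \<omega>)"
proof -
  obtain K1 where K1: "\<forall>f\<in>V. L2_norm N (S f) \<le> L2_norm M f * K1"
    using S unfolding cont_linear_L2_def by (elim conjE exE)
  obtain K2 where K2: "\<forall>f\<in>V. L2_norm N (T f) \<le> L2_norm M f * K2"
    using T unfolding cont_linear_L2_def by (elim conjE exE)
  have L2: "S f \<in> L2_space N" "T f \<in> L2_space N" if "f \<in> V" for f
    using S T that by (auto simp: cont_linear_L2_def)
  have lin: "L2_eq N (S (\<lambda>x. c * f x + d * g x)) (\<lambda>y. c * S f y + d * S g y)"
    "L2_eq N (T (\<lambda>x. c * f x + d * g x)) (\<lambda>y. c * T f y + d * T g y)"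
    if "f \<in> V" "g \<in> V" for f g c d
    using S T that by (auto simp: cont_linear_L2_def)
  show ?thesis
    unfolding cont_linear_L2_def
  proof (intro conjI ballI allI exI)
    show "(\<lambda>\<omega>. a * S f \<omega> + b * T f \<omega>) \<in> L2_space N" if "f \<in> V" for f
      using L2[OF that] by (intro L2_space_add L2_space_cmult)
    show "L2_eq N (\<lambda>\<omega>. a * S (\<lambda>x. c * f x + d * g x) \<omega> + b * T (\<lambda>x. c * f x + d * g x) \<omega>)
        (\<lambda>\<omega>. c * (a * S f \<omega> + b * T f \<omega>) + d * (a * S g \<omega> + b * T g \<omega>))"
      if fg: "f \<in> V" "g \<in> V" for f g c d
    proof (rule L2_eqI)
      show "(\<lambda>\<omega>. a * S (\<lambda>x. c * f x + d * g x) \<omega> + b * T (\<lambda>x. c * f x + d * g x) \<omega>) \<in> L2_space N"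
        using lin[OF fg, of c d] unfolding L2_eq_def by (intro L2_space_add L2_space_cmult) simp_all
      show "(\<lambda>\<omega>. c * (a * S f \<omega> + b * T f \<omega>) + d * (a * S g \<omega> + b * T g \<omega>)) \<in> L2_space N"
        using L2 fg by (intro L2_space_add L2_space_cmult)
      have "AE \<omega> in N. S (\<lambda>x. c * f x + d * g x) \<omega> = c * S f \<omega> + d * S g \<omega>"
        "AE \<omega> in N. T (\<lambda>x. c * f x + d * g x) \<omega> = c * T f \<omega> + d * T g \<omega>"
        using lin[OF fg, of c d] by (simp_all add: L2_eq_def)
      then show "AE \<omega> in N. a * S (\<lambda>x. c * f x + d * g x) \<omega> + b * T (\<lambda>x. c * f x + d * g x) \<omega>
          = c * (a * S f \<omega> + b * T f \<omega>) + d * (a * S g \<omega> + b * T g \<omega>)"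
        by eventually_elim (simp add: algebra_simps)
    qed
    show "L2_norm N (\<lambda>\<omega>. a * S f \<omega> + b * T f \<omega>) \<le> L2_norm M f * (\<bar>a\<bar> * K1 + \<bar>b\<bar> * K2)"
      if "f \<in> V" for f
    proof -
      have "L2_norm N (\<lambda>\<omega>. a * S f \<omega> + b * T f \<omega>) \<le> \<bar>a\<bar> * L2_norm N (S f) + \<bar>b\<bar> * L2_norm N (T f)"
        using L2_norm_triangle[OF L2_space_cmult[OF L2(1)[OF that], of a] L2_space_cmult[OF L2(2)[OF that], of b]]
        by (simp add: L2_norm_cmult)
      also have "\<dots> \<le> \<bar>a\<bar> * (L2_norm M f * K1) + \<bar>b\<bar> * (L2_norm M f * K2)"
        using K1 K2 that by (intro add_mono mult_left_mono) auto
      finally show ?thesis by (simp add: algebra_simps)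
    qed
  qed
qed

text \<open>The input has norm 0, and the norm bound forces the output to have norm 0. This is how
  the operator part of the bracket disappears.\<close>

lemma cont_linear_L2_AE_zero:
  assumes T: "cont_linear_L2 M V N T" and f: "f \<in> V" "f \<in> L2_space M" "AE x in M. f x = 0"
  shows "L2_eq N (T f) (\<lambda>_. 0)"
proof -
  obtain K where "\<forall>f\<in>V. L2_norm N (T f) \<le> L2_norm M f * K"
    using T unfolding cont_linear_L2_def by (elim conjE exE)
  moreover have "L2_norm M f = 0" using f L2_norm_eq_0_iff by blast
  ultimately have "L2_norm N (T f) \<le> 0" using f(1) by force
  then have "L2_norm N (T f) = 0" using L2_norm_nonneg[of N "T f"] by simp
  moreover have "T f \<in> L2_space N" using T f(1) by (simp add: cont_linear_L2_def)
  ultimately show ?thesis by (simp add: L2_eq_def L2_space_zero L2_norm_eq_0_iff)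
qed

lemma UN_atLeastAtMost_one: "(\<Union>n. {1..n}) = {1::nat..}"
  by auto

lemma UN_triangle: "(\<Union>n. SIGMA j:{2..n}. {1..j-1}) = {(j, k::nat). 1 \<le> k \<and> k < j}"
proof -
  have "(j, k) \<in> (SIGMA j:{2..j}. {1..j-1})" if "1 \<le> k" "k < j" for j k :: nat
    using that by auto
  then show ?thesis by (force simp del: mem_Sigma_iff intro: UN_I)
qed

section \<open>The chaos maps as coefficient transfers\<close>

locale chaos_setting = moment_sequence N X K + M: prob_space M
  for N :: "'e measure" and X K and M :: "'a measure" +
  fixes e :: "nat \<Rightarrow> 'a \<Rightarrow> real"
  assumes basis: "hilbert_basis M e"
begin

lemma e_orthonormal: "L2_orthonormal_on M {1..} e"
  using basis by (rule hilbert_basis_orthonormal)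

lemma e_L2: "j \<ge> 1 \<Longrightarrow> e j \<in> L2_space M"
  using basis by (simp add: hilbert_basis_def)

lemma e_inner: "j \<ge> 1 \<Longrightarrow> k \<ge> 1 \<Longrightarrow> L2_inner M (e j) (e k) = (if j = k then 1 else 0)"
  using basis by (simp add: hilbert_basis_def)

lemma ee_L2: "j \<ge> 1 \<Longrightarrow> k \<ge> 1 \<Longrightarrow> e j \<otimes>\<^sub>f e k \<in> L2_space (M \<Otimes>\<^sub>M M)"
  by (intro M.L2_space_tensor e_L2)

lemma ee_inner:
  assumes "j \<ge> 1" "k \<ge> 1" "a \<ge> 1" "b \<ge> 1"
  shows "L2_inner (M \<Otimes>\<^sub>M M) (e j \<otimes>\<^sub>f e k) (e a \<otimes>\<^sub>f e b) = (if j = a \<and> k = b then 1 else 0)"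
  using assms by (simp add: M.L2_inner_tensor e_L2 e_inner)

lemma ee_orthonormal: "L2_orthonormal_on (M \<Otimes>\<^sub>M M) {(j, k). 1 \<le> k \<and> k < j} (\<lambda>(j, k). e j \<otimes>\<^sub>f e k)"
  by (auto simp: L2_orthonormal_on_def L2_orthogonal_on_def ee_L2 ee_inner)

lemma ee_diag_orthonormal: "L2_orthonormal_on (M \<Otimes>\<^sub>M M) {1..} (\<lambda>j. e j \<otimes>\<^sub>f e j)"
  by (auto simp: L2_orthonormal_on_def L2_orthogonal_on_def ee_L2 ee_inner)

sublocale Phi: orthogonal_transfer M N "\<lambda>n. {1..n}" e X 1
  by unfold_locales
    (use e_orthonormal X_orthonormal in \<open>auto simp: UN_atLeastAtMost_one L2_orthonormal_on_def incseq_def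
      simp del: One_nat_def\<close>)

sublocale phi2: orthogonal_transfer "M \<Otimes>\<^sub>M M" N "\<lambda>n. {1..n}" "\<lambda>j. e j \<otimes>\<^sub>f e j"
    "\<lambda>j \<omega>. (X j \<omega>)\<^sup>2 - 1" K
  by unfold_locales
    (use ee_diag_orthonormal X_sq_minus_one_orthogonal in \<open>auto simp: UN_atLeastAtMost_one incseq_def
      X_sq_minus_one_bound K_nonneg simp del: One_nat_def\<close>)

text \<open>An auxiliary map: the series with terms \<open>third_moment j * X j\<close> that is
  subtracted in \<open>Phi_circ2\<close>.\<close>

sublocale phi3: orthogonal_transfer "M \<Otimes>\<^sub>M M" N "\<lambda>n. {1..n}" "\<lambda>j. e j \<otimes>\<^sub>f e j"
    "\<lambda>j \<omega>. third_moment j * X j \<omega>" K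
  by unfold_locales
    (use ee_diag_orthonormal scaled_third_orthogonal[OF X_orthonormal] in
      \<open>auto simp: UN_atLeastAtMost_one incseq_def scaled_third_bound[OF X_orthonormal] K_nonneg
        simp del: One_nat_def\<close>)

sublocale a12: orthogonal_transfer "M \<Otimes>\<^sub>M M" M "\<lambda>n. {1..n}" "\<lambda>j. e j \<otimes>\<^sub>f e j"
    "\<lambda>j x. third_moment j * e j x" K
  by unfold_locales
    (use ee_diag_orthonormal scaled_third_orthogonal[OF e_orthonormal] in
      \<open>auto simp: UN_atLeastAtMost_one incseq_def scaled_third_bound[OF e_orthonormal] K_nonneg
        simp del: One_nat_def\<close>)

text \<open>The index pairs \<open>(j, k)\<close> have the larger index first, and the finite
  triangles reproduce the iterated partial sums of \<open>phi11\<close>.\<close>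

sublocale phi11: orthogonal_transfer "M \<Otimes>\<^sub>M M" N "\<lambda>n. SIGMA j:{2..n}. {1..j-1}"
    "\<lambda>(j, k). e j \<otimes>\<^sub>f e k" "\<lambda>(j, k) \<omega>. X k \<omega> * X j \<omega>" 1
proof
  show "incseq (\<lambda>n. SIGMA j:{2..n}. {1..j-1})" by (auto simp: incseq_def)
  show "L2_orthonormal_on (M \<Otimes>\<^sub>M M) (\<Union>n. SIGMA j:{2..n}. {1..j-1}) (\<lambda>(j, k). e j \<otimes>\<^sub>f e k)"
    unfolding UN_triangle by (rule ee_orthonormal)
  show "L2_orthogonal_on N (\<Union>n. SIGMA j:{2..n}. {1..j-1}) (\<lambda>(j, k) \<omega>. X k \<omega> * X j \<omega>)"
    using X_mult_orthonormal unfolding UN_triangle L2_orthonormal_on_def by blast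
  show "L2_inner N ((\<lambda>(j, k) \<omega>. X k \<omega> * X j \<omega>) i) ((\<lambda>(j, k) \<omega>. X k \<omega> * X j \<omega>) i) \<le> 1"
    if "i \<in> (\<Union>n. SIGMA j:{2..n}. {1..j-1})" for i
    using X_mult_orthonormal that unfolding UN_triangle L2_orthonormal_on_def by auto
qed auto

lemma Phi_eq: "Phi N X M e = Phi.T"
  by (simp add: fun_eq_iff Phi_def L2_transfer_def)

lemma phi2_eq: "phi2 N X M e = phi2.T"
  by (simp add: fun_eq_iff phi2_def L2_transfer_def)

lemma phi11_eq: "phi11 N X M e = phi11.T"
proof -
  have "(\<Sum>j=2..n. (\<Sum>k=1..j-1. c j k * X k \<omega>) * X j \<omega>)
      = (\<Sum>(j, k)\<in>(SIGMA j:{2..n}. {1..j-1}). c j k * (X k \<omega> * X j \<omega>))" for c n \<omega>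
    by (simp add: sum.Sigma[symmetric] sum_distrib_right mult.assoc)
  then show ?thesis
    by (simp add: fun_eq_iff phi11_def L2_transfer_def case_prod_unfold)
qed

text \<open>For \<open>j = k\<close> the two halves fall on the same tensor and add up to 1; for
  \<open>j\<close> different from \<open>k\<close> each of the two tensors receives one
  half.\<close>

lemma symmetrize_ee_inner:
  assumes "j \<ge> 1" "k \<ge> 1" "a \<ge> 1" "b \<ge> 1"
  shows "L2_inner (M \<Otimes>\<^sub>M M) (symmetrize (e j \<otimes>\<^sub>f e k)) (e a \<otimes>\<^sub>f e b)
    = ((if j = a \<and> k = b then 1 else 0) + (if j = b \<and> k = a then 1 else 0)) / 2"
  using assms by (simp add: M.L2_inner_symmetrize_tensor ee_L2 e_L2 ee_inner)

lemma symmetrize_ee_L2: "j \<ge> 1 \<Longrightarrow> k \<ge> 1 \<Longrightarrow> symmetrize (e j \<otimes>\<^sub>f e k) \<in> L2_space (M \<Otimes>\<^sub>M M)"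
  by (intro M.L2_space_symmetrize ee_L2)

lemma L2_sym_subset: "L2_sym M \<subseteq> L2_space (M \<Otimes>\<^sub>M M)"
  by (auto simp: L2_sym_def)

text \<open>A map defined by choice has its defining properties only if some map has them; the
  transfer \<open>a12.T\<close> is such a map.\<close>

lemma a12_cont_linear: "cont_linear_L2 (M \<Otimes>\<^sub>M M) (L2_sym M) M (a12 N X M e)"
proof -
  have off: "L2_eq M (a12.T (symmetrize (e j \<otimes>\<^sub>f e k))) (\<lambda>_. 0)" if "j \<ge> 1" "k \<ge> 1" "j \<noteq> k" for j k
    using that by (intro a12.T_eq_zero symmetrize_ee_L2) (auto simp: symmetrize_ee_inner)
  have diag: "L2_eq M (a12.T (symmetrize (e j \<otimes>\<^sub>f e j))) (\<lambda>x. third_moment j * e j x)"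
    if j: "j \<ge> 1" for j
  proof -
    have "L2_eq M (a12.T (symmetrize (e j \<otimes>\<^sub>f e j))) (\<lambda>x. 1 * (third_moment j * e j x))"
      by (rule a12.T_eq_single[OF symmetrize_ee_L2[OF j j]], unfold UN_atLeastAtMost_one)
        (use j in \<open>auto simp: symmetrize_ee_inner\<close>)
    then show ?thesis by simp
  qed
  show ?thesis
    unfolding a12_def third_moment_def[symmetric]
    by (rule someI2[where a = a12.T])
      (intro conjI allI impI a12.cont_linear L2_sym_subset off diag, assumption+, elim conjE)
qed

text \<open>Existence is again the point, with a combination of \<open>phi11.T\<close>,
  \<open>phi2.T\<close> and \<open>phi3.T\<close> as witness.\<close>

lemma Phi_circ2_cont_linear: "cont_linear_L2 (M \<Otimes>\<^sub>M M) (L2_sym M) N (Phi_circ2 N X M e)"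
proof -
  \<comment> \<open>The factor 2 undoes the one half that symmetrization leaves on an off-diagonal
    tensor. The redundant coefficients 1 give the shape in which the combination lemma applies
    twice.\<close>
  define T where "T f \<omega> = 2 * phi11.T f \<omega> + 1 * (1 * phi2.T f \<omega> + (-1) * phi3.T f \<omega>)" for f \<omega>
  have T_eq: "T = (\<lambda>f \<omega>. 2 * phi11.T f \<omega> + 1 * (1 * phi2.T f \<omega> + (-1) * phi3.T f \<omega>))"
    by (simp add: fun_eq_iff T_def)
  have T_L2: "T f \<in> L2_space N" if "f \<in> L2_space (M \<Otimes>\<^sub>M M)" for f
    unfolding T_eq
    by (intro L2_space_add L2_space_cmult phi11.T_L2 phi2.T_L2 phi3.T_L2 that)
  have off: "L2_eq N (T (symmetrize (e j \<otimes>\<^sub>f e k))) (\<lambda>\<omega>. X j \<omega> * X k \<omega>)"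
    if jk: "j \<ge> 1" "k \<ge> 1" "j \<noteq> k" for j k
  proof -
    let ?f = "symmetrize (e j \<otimes>\<^sub>f e k)"
    note f = symmetrize_ee_L2[OF jk(1,2)]
    \<comment> \<open>Of the two tensors in the symmetrization, only the one with the larger index
      first is seen by \<open>phi11.T\<close>.\<close>
    have "L2_eq N (phi11.T ?f) (\<lambda>\<omega>. (1/2) * (case (max j k, min j k) of (j, k) \<Rightarrow> \<lambda>\<omega>. X k \<omega> * X j \<omega>) \<omega>)"
    proof (rule phi11.T_eq_single[OF f])
      show "(max j k, min j k) \<in> (\<Union>n. SIGMA j:{2..n}. {1..j-1})"
        unfolding UN_triangle using jk by auto
      show "L2_inner (M \<Otimes>\<^sub>M M) ?f (case i of (j, k) \<Rightarrow> e j \<otimes>\<^sub>f e k)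
          = (if i = (max j k, min j k) then 1/2 else 0)"
        if "i \<in> (\<Union>n. SIGMA j:{2..n}. {1..j-1})" for i
        using that jk unfolding UN_triangle by (auto simp: symmetrize_ee_inner max_def min_def split: if_splits)
    qed
    moreover have "(case (max j k, min j k) of (j, k) \<Rightarrow> \<lambda>\<omega>. X k \<omega> * X j \<omega>) \<omega> = X j \<omega> * X k \<omega>" for \<omega>
      by (simp add: max_def min_def mult.commute)
    ultimately have 1: "AE \<omega> in N. phi11.T ?f \<omega> = (1/2) * (X j \<omega> * X k \<omega>)"
      by (simp add: L2_eq_def)
    have "L2_eq N (phi2.T ?f) (\<lambda>_. 0)"
      using jk by (intro phi2.T_eq_zero f) (auto simp: symmetrize_ee_inner)
    moreover have "L2_eq N (phi3.T ?f) (\<lambda>_. 0)"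
      using jk by (intro phi3.T_eq_zero f) (auto simp: symmetrize_ee_inner)
    ultimately have 2: "AE \<omega> in N. phi2.T ?f \<omega> = 0" "AE \<omega> in N. phi3.T ?f \<omega> = 0"
      by (auto simp: L2_eq_def)
    show ?thesis
    proof (rule L2_eq_sym, rule L2_eqI[OF _ T_L2[OF f]])
      show "AE \<omega> in N. X j \<omega> * X k \<omega> = T ?f \<omega>"
        using 1 2 by eventually_elim (simp add: T_def)
      then show "(\<lambda>\<omega>. X j \<omega> * X k \<omega>) \<in> L2_space N"
        using jk by (intro L2_space_cong_AE[OF T_L2[OF f]] borel_measurable_times X_measurable) auto
    qed
  qed
  have diag: "L2_eq N (T (symmetrize (e j \<otimes>\<^sub>f e j))) (\<lambda>\<omega>. (X j \<omega>)\<^sup>2 - third_moment j * X j \<omega> - 1)"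
    if j: "j \<ge> 1" for j
  proof -
    let ?f = "symmetrize (e j \<otimes>\<^sub>f e j)"
    note f = symmetrize_ee_L2[OF j j]
    have "L2_eq N (phi11.T ?f) (\<lambda>_. 0)"
      by (rule phi11.T_eq_zero[OF f], unfold UN_triangle) (use j in \<open>auto simp: symmetrize_ee_inner\<close>)
    moreover have "L2_eq N (phi2.T ?f) (\<lambda>\<omega>. 1 * ((X j \<omega>)\<^sup>2 - 1))"
      by (rule phi2.T_eq_single[OF f], unfold UN_atLeastAtMost_one)
        (use j in \<open>auto simp: symmetrize_ee_inner\<close>)
    moreover have "L2_eq N (phi3.T ?f) (\<lambda>\<omega>. 1 * (third_moment j * X j \<omega>))"
      by (rule phi3.T_eq_single[OF f], unfold UN_atLeastAtMost_one)
        (use j in \<open>auto simp: symmetrize_ee_inner\<close>)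
    ultimately have ae: "AE \<omega> in N. phi11.T ?f \<omega> = 0" "AE \<omega> in N. phi2.T ?f \<omega> = (X j \<omega>)\<^sup>2 - 1"
      "AE \<omega> in N. phi3.T ?f \<omega> = third_moment j * X j \<omega>"
      by (simp_all add: L2_eq_def)
    show ?thesis
    proof (rule L2_eqI[OF T_L2[OF f]])
      show "AE \<omega> in N. T ?f \<omega> = (X j \<omega>)\<^sup>2 - third_moment j * X j \<omega> - 1"
        using ae by eventually_elim (simp add: T_def)
      show "(\<lambda>\<omega>. (X j \<omega>)\<^sup>2 - third_moment j * X j \<omega> - 1) \<in> L2_space N"
        using j by (intro L2_space_diff L2_space_cmult L2_space_const X_L2 X_sq_L2)
    qed
  qed
  have cont: "cont_linear_L2 (M \<Otimes>\<^sub>M M) (L2_sym M) N T"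
    unfolding T_eq
    by (intro cont_linear_L2_combination phi11.cont_linear phi2.cont_linear phi3.cont_linear L2_sym_subset)
  show ?thesis
    unfolding Phi_circ2_def third_moment_def[symmetric]
    by (rule someI2[where a = T])
      (intro conjI allI impI cont off diag, assumption+, elim conjE)
qed

lemma Phi_circ2_Phi_a12_AE_zero:
  assumes "d \<in> L2_sym M" "AE p in M \<Otimes>\<^sub>M M. d p = 0"
  shows "AE \<omega> in N. Phi_circ2 N X M e d \<omega> + Phi N X M e (a12 N X M e d) \<omega> = 0"
proof -
  have d: "d \<in> L2_space (M \<Otimes>\<^sub>M M)" using assms(1) L2_sym_subset by blast
  have "L2_eq N (Phi_circ2 N X M e d) (\<lambda>_. 0)"
    by (rule cont_linear_L2_AE_zero[OF Phi_circ2_cont_linear assms(1) d assms(2)])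
  moreover have "L2_eq M (a12 N X M e d) (\<lambda>_. 0)"
    by (rule cont_linear_L2_AE_zero[OF a12_cont_linear assms(1) d assms(2)])
  then have "L2_eq N (Phi N X M e (a12 N X M e d)) (\<lambda>_. 0)"
    unfolding Phi_eq L2_eq_def
    by (intro cont_linear_L2_AE_zero[OF Phi.cont_linear[OF order_refl], unfolded L2_eq_def]) simp_all
  ultimately have "AE \<omega> in N. Phi_circ2 N X M e d \<omega> = 0" "AE \<omega> in N. Phi N X M e (a12 N X M e d) \<omega> = 0"
    by (simp_all add: L2_eq_def)
  then show ?thesis by eventually_elim simp
qed

end

subsection \<open>The product formula\<close>

text \<open>The products converge to \<open>f * g\<close> in L1 by Cauchy-Schwarz and to
  \<open>r\<close> in L2, hence in L1; uniqueness of the L1 limit identifies the two and puts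
  \<open>f * g\<close> into L2.\<close>

lemma (in prob_space) L2_eq_mult_limit:
  assumes u: "L2_tendsto M u f" and v: "L2_tendsto M v g" and w: "L2_tendsto M (\<lambda>n x. u n x * v n x) r"
  shows "L2_eq M (\<lambda>x. f x * g x) r"
proof -
  note L2 = u[unfolded L2_tendsto_def] v[unfolded L2_tendsto_def] w[unfolded L2_tendsto_def]
  have un: "u n \<in> L2_space M" and vn: "v n \<in> L2_space M" and f: "f \<in> L2_space M" and g: "g \<in> L2_space M"
    and r: "r \<in> L2_space M" and wn: "(\<lambda>x. u n x * v n x) \<in> L2_space M" for n
    using L2 by auto
  \<comment> \<open>The difference \<open>f * g - r\<close> is split by inserting
    \<open>u n * g\<close> and \<open>u n * v n\<close>. The norms of \<open>u n\<close> converge,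
    so all three terms tend to 0.\<close>
  define bound where "bound n = L2_norm M (\<lambda>x. u n x - f x) * L2_norm M g
    + L2_norm M (u n) * L2_norm M (\<lambda>x. v n x - g x) + L2_norm M (\<lambda>x. u n x * v n x - r x)" for n
  have "(\<integral>x. \<bar>f x * g x - r x\<bar> \<partial>M) \<le> bound n" for n
  proof -
    have int: "integrable M (\<lambda>x. \<bar>(u n x - f x) * g x\<bar>)" "integrable M (\<lambda>x. \<bar>u n x * (v n x - g x)\<bar>)"
      "integrable M (\<lambda>x. \<bar>u n x * v n x - r x\<bar>)" "integrable M (\<lambda>x. \<bar>f x * g x - r x\<bar>)"
      by (intro integrable_abs L2_space_mult_integrable L2_space_diff L2_space_integrable
          Bochner_Integration.integrable_diff un vn f g r wn)+
    have "(\<integral>x. \<bar>f x * g x - r x\<bar> \<partial>M) \<le> (\<integral>x. \<bar>(u n x - f x) * g x\<bar> + \<bar>u n x * (v n x - g x)\<bar>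
        + \<bar>u n x * v n x - r x\<bar> \<partial>M)"
    proof (rule integral_mono)
      show "\<bar>f x * g x - r x\<bar> \<le> \<bar>(u n x - f x) * g x\<bar> + \<bar>u n x * (v n x - g x)\<bar>
        + \<bar>u n x * v n x - r x\<bar>" for x
      proof -
        have "f x * g x - r x = - ((u n x - f x) * g x) - u n x * (v n x - g x) + (u n x * v n x - r x)"
          by (simp add: algebra_simps)
        then show ?thesis by linarith
      qed
    qed (use int in auto)
    also have "\<dots> = (\<integral>x. \<bar>(u n x - f x) * g x\<bar> \<partial>M) + (\<integral>x. \<bar>u n x * (v n x - g x)\<bar> \<partial>M)
        + (\<integral>x. \<bar>u n x * v n x - r x\<bar> \<partial>M)"
      using int by simp
    also have "\<dots> \<le> bound n"
      unfolding bound_def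
      by (intro add_mono integral_abs_mult_le_L2_norm integral_abs_le_L2_norm L2_space_diff un vn f g r wn)
    finally show ?thesis .
  qed
  moreover have "bound \<longlonglongrightarrow> 0 * L2_norm M g + L2_norm M f * 0 + 0"
    unfolding bound_def using L2 by (intro tendsto_intros L2_tendsto_norm[OF u]) auto
  then have "bound \<longlonglongrightarrow> 0" by simp
  ultimately have "(\<integral>x. \<bar>f x * g x - r x\<bar> \<partial>M) \<le> 0"
    by (intro LIMSEQ_le_const) auto
  then have "(\<integral>x. \<bar>f x * g x - r x\<bar> \<partial>M) = 0"
    by (intro antisym integral_nonneg_AE) auto
  moreover have "integrable M (\<lambda>x. \<bar>f x * g x - r x\<bar>)"
    by (intro integrable_abs L2_space_mult_integrable L2_space_integrable
        Bochner_Integration.integrable_diff f g r)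
  ultimately have "AE x in M. \<bar>f x * g x - r x\<bar> = 0"
    using integral_nonneg_eq_0_iff_AE[of M "\<lambda>x. \<bar>f x * g x - r x\<bar>"] by simp
  then have ae: "AE x in M. r x = f x * g x" by eventually_elim simp
  then have "(\<lambda>x. f x * g x) \<in> L2_space M"
    by (rule L2_space_cong_AE[OF r borel_measurable_times[OF L2_spaceD(1)[OF f] L2_spaceD(1)[OF g]]])
  with ae r show ?thesis by (auto simp: L2_eq_def)
qed

lemma (in prob_space) L2_tendsto_real:
  assumes "c \<longlonglongrightarrow> l"
  shows "L2_tendsto M (\<lambda>n x. c n) (\<lambda>x. l)"
proof -
  have "(\<lambda>n. \<bar>c n - l\<bar>) \<longlonglongrightarrow> 0"
    using assms by (intro tendsto_rabs_zero LIM_zero)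
  then show ?thesis
    by (simp add: L2_tendsto_def L2_space_const L2_norm_def L2_inner_def prob_space)
qed

text \<open>Off the diagonal, the two orders of an index pair are merged into one term with
  \<open>k < j\<close>. The induction adds one row of the triangle and one diagonal term.\<close>

lemma sum_mult_sum_triangle:
  fixes a b x :: "nat \<Rightarrow> real"
  shows "(\<Sum>j=1..n. a j * x j) * (\<Sum>j=1..n. b j * x j)
    = (\<Sum>j=2..n. \<Sum>k=1..j-1. (a j * b k + b j * a k) * (x k * x j)) + (\<Sum>j=1..n. a j * b j * (x j)\<^sup>2)"
proof (induction n)
  case (Suc n)
  let ?A = "\<Sum>j=1..n. a j * x j" and ?B = "\<Sum>j=1..n. b j * x j"
  have "(\<Sum>k=1..n. (a (Suc n) * b k + b (Suc n) * a k) * (x k * x (Suc n)))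
      = a (Suc n) * x (Suc n) * ?B + b (Suc n) * x (Suc n) * ?A"
    by (simp add: sum_distrib_left sum.distrib[symmetric] algebra_simps)
  moreover have "(\<Sum>j=2..Suc n. \<Sum>k=1..j-1. (a j * b k + b j * a k) * (x k * x j))
      = (\<Sum>j=2..n. \<Sum>k=1..j-1. (a j * b k + b j * a k) * (x k * x j))
        + (\<Sum>k=1..n. (a (Suc n) * b k + b (Suc n) * a k) * (x k * x (Suc n)))"
    \<comment> \<open>For \<open>n = 0\<close> the rows starting at 2 and the new row are all
      empty.\<close>
    by (cases "n = 0") auto
  ultimately show ?case
    using Suc by (simp add: algebra_simps power2_eq_square)
qed simp

context chaos_setting
begin

text \<open>The formula for arbitrary kernels: it depends only on the sums of their coefficients, so
  the geometry of the triangles enters only when \<open>off\<close> and \<open>diag\<close> are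
  checked.\<close>

lemma Phi_mult_Phi:
  assumes h: "h \<in> L2_space M" and g: "g \<in> L2_space M"
    and F: "F \<in> L2_space (M \<Otimes>\<^sub>M M)" and G: "G \<in> L2_space (M \<Otimes>\<^sub>M M)"
    and F2: "F2 \<in> L2_space (M \<Otimes>\<^sub>M M)" and G2: "G2 \<in> L2_space (M \<Otimes>\<^sub>M M)"
    and off: "\<And>j k. j \<ge> 1 \<Longrightarrow> k \<ge> 1 \<Longrightarrow>
      L2_inner (M \<Otimes>\<^sub>M M) F (e j \<otimes>\<^sub>f e k) + L2_inner (M \<Otimes>\<^sub>M M) G (e j \<otimes>\<^sub>f e k)
      = L2_inner M h (e j) * L2_inner M g (e k) + L2_inner M g (e j) * L2_inner M h (e k)"
    and diag: "\<And>j. j \<ge> 1 \<Longrightarrow>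
      L2_inner (M \<Otimes>\<^sub>M M) F2 (e j \<otimes>\<^sub>f e j) + L2_inner (M \<Otimes>\<^sub>M M) G2 (e j \<otimes>\<^sub>f e j)
      = L2_inner M h (e j) * L2_inner M g (e j)"
  shows "L2_eq N (\<lambda>\<omega>. Phi N X M e h \<omega> * Phi N X M e g \<omega>)
    (\<lambda>\<omega>. (phi11 N X M e F \<omega> + phi2 N X M e F2 \<omega>) + (phi11 N X M e G \<omega> + phi2 N X M e G2 \<omega>)
      + L2_inner M h g)"
  unfolding Phi_eq phi11_eq phi2_eq
proof (rule L2_eq_mult_limit[OF Phi.tendsto[OF h] Phi.tendsto[OF g]])
  \<comment> \<open>\<open>c n\<close> compensates the -1 in the terms \<open>(X j)^2 - 1\<close>
    and becomes the inner product in the limit.\<close>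
  define c where "c n = (\<Sum>j=1..n. L2_inner M h (e j) * L2_inner M g (e j))" for n
  have eq: "Phi.partial h n \<omega> * Phi.partial g n \<omega>
    = (phi11.partial F n \<omega> + phi2.partial F2 n \<omega>) + (phi11.partial G n \<omega> + phi2.partial G2 n \<omega>) + c n"
    for n \<omega>
  proof -
    have "phi11.partial F n \<omega> + phi11.partial G n \<omega> =
        (\<Sum>(j, k)\<in>(SIGMA j:{2..n}. {1..j-1}). (L2_inner M h (e j) * L2_inner M g (e k)
          + L2_inner M g (e j) * L2_inner M h (e k)) * (X k \<omega> * X j \<omega>))"
      unfolding sum.distrib[symmetric]
      by (intro sum.cong refl) (auto simp: off simp flip: distrib_right)
    also have "\<dots> = (\<Sum>j=2..n. \<Sum>k=1..j-1. (L2_inner M h (e j) * L2_inner M g (e k)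
          + L2_inner M g (e j) * L2_inner M h (e k)) * (X k \<omega> * X j \<omega>))"
      by (simp add: sum.Sigma)
    finally have 1: "phi11.partial F n \<omega> + phi11.partial G n \<omega> = \<dots>" .
    have "phi2.partial F2 n \<omega> + phi2.partial G2 n \<omega>
        = (\<Sum>j=1..n. L2_inner M h (e j) * L2_inner M g (e j) * ((X j \<omega>)\<^sup>2 - 1))"
      unfolding sum.distrib[symmetric]
      by (intro sum.cong refl) (auto simp: diag[symmetric] ring_distribs)
    also have "\<dots> = (\<Sum>j=1..n. L2_inner M h (e j) * L2_inner M g (e j) * (X j \<omega>)\<^sup>2) - c n"
      by (simp add: c_def right_diff_distrib sum_subtractf)
    finally have 2: "phi2.partial F2 n \<omega> + phi2.partial G2 n \<omega> = \<dots>" .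
    show ?thesis
      unfolding sum_mult_sum_triangle using 1 2 by linarith
  qed
  have "c \<longlonglongrightarrow> L2_inner M h g"
    unfolding c_def by (rule hilbert_basis_Parseval[OF basis h g])
  then show "L2_tendsto N (\<lambda>n \<omega>. Phi.partial h n \<omega> * Phi.partial g n \<omega>)
      (\<lambda>\<omega>. (phi11.T F \<omega> + phi2.T F2 \<omega>) + (phi11.T G \<omega> + phi2.T G2 \<omega>) + L2_inner M h g)"
    unfolding eq
    by (intro L2_tendsto_add phi11.tendsto phi2.tendsto L2_tendsto_real F G F2 G2)
qed

end


section \<open>The triangles and the diagonal in the unit square\<close>

lemma sets_triangles:
  fixes M :: "real measure"
  assumes "sets M = sets borel"
  shows "set_C \<in> sets (M \<Otimes>\<^sub>M M)" "set_C' \<in> sets (M \<Otimes>\<^sub>M M)" "diagonal \<in> sets (M \<Otimes>\<^sub>M M)"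
proof -
  have eq: "sets (M \<Otimes>\<^sub>M M) = sets (borel \<Otimes>\<^sub>M (borel :: real measure))"
    by (intro sets_pair_measure_cong assms)
  have "set_C = {p \<in> space (borel \<Otimes>\<^sub>M borel). 0 \<le> fst p \<and> fst p < snd p \<and> snd p \<le> 1}"
    by (auto simp: set_C_def space_pair_measure)
  also have "\<dots> \<in> sets (borel \<Otimes>\<^sub>M borel)" by measurable
  finally show "set_C \<in> sets (M \<Otimes>\<^sub>M M)" unfolding eq .
  have "set_C' = {p \<in> space (borel \<Otimes>\<^sub>M borel). 0 \<le> snd p \<and> snd p < fst p \<and> fst p \<le> 1}"
    by (auto simp: set_C'_def space_pair_measure)
  also have "\<dots> \<in> sets (borel \<Otimes>\<^sub>M borel)" by measurable
  finally show "set_C' \<in> sets (M \<Otimes>\<^sub>M M)" unfolding eq .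
  have "diagonal = {p \<in> space (borel \<Otimes>\<^sub>M (borel :: real measure)). fst p = snd p}"
    by (auto simp: diagonal_def space_pair_measure)
  also have "\<dots> \<in> sets (borel \<Otimes>\<^sub>M borel)" by measurable
  finally show "diagonal \<in> sets (M \<Otimes>\<^sub>M M)" unfolding eq .
qed

text \<open>A point of the unit square with distinct coordinates lies in exactly one triangle.
  Almost every point is of this kind: the coordinates lie in the unit interval by
  \<open>unit\<close>, and each section of the diagonal is a singleton, null by
  \<open>diffuse\<close>.\<close>

lemma AE_triangles:
  fixes M :: "real measure"
  assumes "prob_space M" and sets: "sets M = sets borel"
    and diffuse: "\<And>x. emeasure M {x} = 0" and unit: "emeasure M {0..1} = 1"
  shows "AE p in M \<Otimes>\<^sub>M M. p \<notin> diagonal \<and> indicator set_C p + indicator set_C' p = (1::real)"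
proof -
  interpret prob_space M by fact
  interpret pair_sigma_finite M M ..
  have eq: "sets (M \<Otimes>\<^sub>M M) = sets (borel \<Otimes>\<^sub>M (borel :: real measure))"
    by (intro sets_pair_measure_cong sets)
  have unit: "AE x in M. x \<in> {0..1}"
    using unit sets by (intro AE_in_set_eq_1[THEN iffD2]) (auto simp: measure_def)
  let ?P = "\<lambda>p::real \<times> real. fst p \<in> {0..1} \<and> snd p \<in> {0..1} \<and> fst p \<noteq> snd p"
  have "AE p in M \<Otimes>\<^sub>M M. ?P p"
  proof (rule AE_pair_measure)
    have "{p \<in> space (borel \<Otimes>\<^sub>M borel). ?P p} \<in> sets (borel \<Otimes>\<^sub>M borel)" by measurable
    then show "{p \<in> space (M \<Otimes>\<^sub>M M). ?P p} \<in> sets (M \<Otimes>\<^sub>M M)"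
      unfolding eq sets_eq_imp_space_eq[OF eq] .
    have "AE y in M. x \<noteq> y" for x
      using diffuse[of x] sets by (intro AE_I[where N = "{x}"]) auto
    then show "AE x in M. AE y in M. ?P (x, y)"
      using unit by auto
  qed
  then show ?thesis
  proof eventually_elim
    case (elim p)
    then have "p \<in> set_C \<longleftrightarrow> p \<notin> set_C'"
      by (cases p) (auto simp: set_C_def set_C'_def)
    with elim show ?case by (cases p) (auto simp: diagonal_def split: split_indicator)
  qed
qed

text \<open>The triangles lie in the unit square while the measure lives on the real line;
  \<open>carried\<close> reconciles the two, since mass outside the square would be lost to the
  integrals.\<close>

locale unit_chaos_setting = chaos_setting N X K M e
  for N :: "'e measure" and X K and M :: "real measure" and e +
  assumes sets_M: "sets M = sets borel"
    and diffuse: "emeasure M {x} = 0"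
    and carried: "emeasure M {0..1} = 1"
begin

lemma tensor_indicator_L2:
  assumes "h \<in> L2_space M" "g \<in> L2_space M" "A \<in> {set_C, set_C', diagonal}"
  shows "(\<lambda>p. (h \<otimes>\<^sub>f g) p * indicator A p) \<in> L2_space (M \<Otimes>\<^sub>M M)"
  using assms sets_triangles[OF sets_M] by (intro L2_space_mult_indicator M.L2_space_tensor) auto

lemma inner_triangles:
  assumes h: "h \<in> L2_space M" and g: "g \<in> L2_space M" and j: "j \<ge> 1" and k: "k \<ge> 1"
  shows "L2_inner (M \<Otimes>\<^sub>M M) (\<lambda>p. (h \<otimes>\<^sub>f g) p * indicator set_C p) (e j \<otimes>\<^sub>f e k)
      + L2_inner (M \<Otimes>\<^sub>M M) (\<lambda>p. (h \<otimes>\<^sub>f g) p * indicator set_C' p) (e j \<otimes>\<^sub>f e k)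
      = L2_inner M h (e j) * L2_inner M g (e k)"
proof -
  have "L2_inner (M \<Otimes>\<^sub>M M) (\<lambda>p. (h \<otimes>\<^sub>f g) p * indicator set_C p) (e j \<otimes>\<^sub>f e k)
      + L2_inner (M \<Otimes>\<^sub>M M) (\<lambda>p. (h \<otimes>\<^sub>f g) p * indicator set_C' p) (e j \<otimes>\<^sub>f e k)
      = L2_inner (M \<Otimes>\<^sub>M M) (\<lambda>p. (h \<otimes>\<^sub>f g) p * indicator set_C p + (h \<otimes>\<^sub>f g) p * indicator set_C' p)
          (e j \<otimes>\<^sub>f e k)"
    by (intro L2_inner_add_left[symmetric] tensor_indicator_L2 ee_L2 h g j k) auto
  also have "\<dots> = L2_inner (M \<Otimes>\<^sub>M M) (h \<otimes>\<^sub>f g) (e j \<otimes>\<^sub>f e k)"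
  proof (rule L2_inner_cong_AE)
    show "(\<lambda>p. (h \<otimes>\<^sub>f g) p * indicator set_C p + (h \<otimes>\<^sub>f g) p * indicator set_C' p)
        \<in> borel_measurable (M \<Otimes>\<^sub>M M)"
      by (intro L2_spaceD(1) L2_space_add tensor_indicator_L2 h g) auto
    show "h \<otimes>\<^sub>f g \<in> borel_measurable (M \<Otimes>\<^sub>M M)" "e j \<otimes>\<^sub>f e k \<in> borel_measurable (M \<Otimes>\<^sub>M M)"
      by (intro tensor_measurable L2_spaceD(1) e_L2 h g j k)+
    show "AE p in M \<Otimes>\<^sub>M M. (h \<otimes>\<^sub>f g) p * indicator set_C p + (h \<otimes>\<^sub>f g) p * indicator set_C' p
        = (h \<otimes>\<^sub>f g) p"
      using AE_triangles[OF M.prob_space_axioms sets_M diffuse carried]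
      by eventually_elim (simp flip: distrib_left)
  qed
  also have "\<dots> = L2_inner M h (e j) * L2_inner M g (e k)"
    by (intro M.L2_inner_tensor e_L2 h g j k)
  finally show ?thesis .
qed

text \<open>Exchanging coordinates carries one triangle to the other and fixes the tensor of
  \<open>e j\<close> with itself. Hence the \<open>phi2\<close> parts of the two integrals together
  yield the full diagonal coefficient.\<close>

lemma inner_swap_triangle:
  assumes h: "h \<in> L2_space M" and g: "g \<in> L2_space M" and j: "j \<ge> 1"
  shows "L2_inner (M \<Otimes>\<^sub>M M) (\<lambda>p. (g \<otimes>\<^sub>f h) p * indicator set_C p) (e j \<otimes>\<^sub>f e j)
    = L2_inner (M \<Otimes>\<^sub>M M) (\<lambda>p. (h \<otimes>\<^sub>f g) p * indicator set_C' p) (e j \<otimes>\<^sub>f e j)"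
proof -
  have "(\<lambda>p. (g \<otimes>\<^sub>f h) p * indicator set_C p)
      = (\<lambda>(x, y). (\<lambda>p. (h \<otimes>\<^sub>f g) p * indicator set_C' p) (y, x))"
    by (auto simp: tensor_def set_C_def set_C'_def split: split_indicator)
  then show ?thesis
    by (simp only:) (intro M.L2_inner_swap_tensor tensor_indicator_L2 e_L2 h g j, simp)
qed

text \<open>The kernel cut to the diagonal is null, so only the constant term survives.\<close>

lemma Phi_bracket_AE:
  assumes h: "h \<in> L2_space M" and g: "g \<in> L2_space M"
  shows "AE \<omega> in N. Phi_bracket N X M e h g \<omega> = L2_inner M h g"
proof -
  interpret MM: pair_sigma_finite M M ..
  define D where "D p = (h \<otimes>\<^sub>f g) p * indicator diagonal p" for p
  have D: "D \<in> L2_space (M \<Otimes>\<^sub>M M)"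
    unfolding D_def by (intro tensor_indicator_L2 h g) simp
  have "symmetrize D p = 0" if "p \<notin> diagonal" for p
    using that by (cases p) (auto simp: symmetrize_def D_def diagonal_def split: split_indicator)
  then have "AE p in M \<Otimes>\<^sub>M M. symmetrize D p = 0"
    using AE_triangles[OF M.prob_space_axioms sets_M diffuse carried] by auto
  then have "AE \<omega> in N. Phi_circ2 N X M e (symmetrize D) \<omega> + Phi N X M e (a12 N X M e (symmetrize D)) \<omega> = 0"
    by (intro Phi_circ2_Phi_a12_AE_zero M.symmetrize_in_L2_sym D)
  then show ?thesis
    unfolding Phi_bracket_def Let_def D_def[abs_def] by eventually_elim simp
qed

text \<open>Equality with a constant almost everywhere does not give measurability, which membership
  in L2 requires.\<close>

lemma Phi_bracket_measurable:
  assumes h: "h \<in> L2_space M" and g: "g \<in> L2_space M"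
  shows "Phi_bracket N X M e h g \<in> borel_measurable N"
proof -
  define d where "d = symmetrize (\<lambda>p. (h \<otimes>\<^sub>f g) p * indicator diagonal p)"
  have d: "d \<in> L2_sym M"
    unfolding d_def by (intro M.symmetrize_in_L2_sym tensor_indicator_L2 h g) simp
  have "Phi_circ2 N X M e d \<in> L2_space N" "a12 N X M e d \<in> L2_space M"
    using d Phi_circ2_cont_linear a12_cont_linear by (auto simp: cont_linear_L2_def)
  then have [measurable]: "Phi_circ2 N X M e d \<in> borel_measurable N"
    "Phi N X M e (a12 N X M e d) \<in> borel_measurable N"
    using Phi.T_L2 unfolding Phi_eq by (auto dest: L2_spaceD(1))
  show ?thesis
    unfolding Phi_bracket_def Let_def d_def[symmetric] by measurable
qed

theorem product_formula:
  assumes h: "h \<in> L2_space M" and g: "g \<in> L2_space M"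
  shows "L2_eq N (\<lambda>\<omega>. Phi N X M e h \<omega> * Phi N X M e g \<omega>)
    (\<lambda>\<omega>. Phi_integral N X M e h g \<omega> + Phi_integral N X M e g h \<omega> + Phi_bracket N X M e h g \<omega>)"
proof -
  let ?hC = "\<lambda>p. (h \<otimes>\<^sub>f g) p * indicator set_C p" and ?hC' = "\<lambda>p. (h \<otimes>\<^sub>f g) p * indicator set_C' p"
  let ?gC = "\<lambda>p. (g \<otimes>\<^sub>f h) p * indicator set_C p" and ?gC' = "\<lambda>p. (g \<otimes>\<^sub>f h) p * indicator set_C' p"
  let ?F = "\<lambda>p. ?hC p + ?gC' p" and ?G = "\<lambda>p. ?gC p + ?hC' p"
  have L2: "?hC \<in> L2_space (M \<Otimes>\<^sub>M M)" "?hC' \<in> L2_space (M \<Otimes>\<^sub>M M)"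
    "?gC \<in> L2_space (M \<Otimes>\<^sub>M M)" "?gC' \<in> L2_space (M \<Otimes>\<^sub>M M)"
    by (auto intro!: tensor_indicator_L2 h g)
  have FG: "?F \<in> L2_space (M \<Otimes>\<^sub>M M)" "?G \<in> L2_space (M \<Otimes>\<^sub>M M)"
    by (intro L2_space_add L2)+
  have prod: "L2_eq N (\<lambda>\<omega>. Phi N X M e h \<omega> * Phi N X M e g \<omega>)
    (\<lambda>\<omega>. Phi_integral N X M e h g \<omega> + Phi_integral N X M e g h \<omega> + L2_inner M h g)"
    unfolding Phi_integral_def
  proof (rule Phi_mult_Phi[OF h g FG L2(1,3)])
    fix j k :: nat assume jk: "j \<ge> 1" "k \<ge> 1"
    show "L2_inner (M \<Otimes>\<^sub>M M) ?F (e j \<otimes>\<^sub>f e k) + L2_inner (M \<Otimes>\<^sub>M M) ?G (e j \<otimes>\<^sub>f e k)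
      = L2_inner M h (e j) * L2_inner M g (e k) + L2_inner M g (e j) * L2_inner M h (e k)"
      \<comment> \<open>The four pieces are regrouped across \<open>?F\<close> and
        \<open>?G\<close>: the two carrying \<open>h\<close> tensor \<open>g\<close> fill the
        square, and so do the two carrying \<open>g\<close> tensor \<open>h\<close>.\<close>
      using inner_triangles[OF h g jk] inner_triangles[OF g h jk]
      by (simp add: L2_inner_add_left[OF L2(1,4) ee_L2[OF jk]] L2_inner_add_left[OF L2(3,2) ee_L2[OF jk]])
  next
    fix j :: nat assume j: "j \<ge> 1"
    show "L2_inner (M \<Otimes>\<^sub>M M) ?hC (e j \<otimes>\<^sub>f e j) + L2_inner (M \<Otimes>\<^sub>M M) ?gC (e j \<otimes>\<^sub>f e j)
      = L2_inner M h (e j) * L2_inner M g (e j)"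
      using inner_triangles[OF h g j j] by (simp add: inner_swap_triangle[OF h g j])
  qed
  have ae: "AE \<omega> in N. Phi_integral N X M e h g \<omega> + Phi_integral N X M e g h \<omega> + L2_inner M h g
      = Phi_integral N X M e h g \<omega> + Phi_integral N X M e g h \<omega> + Phi_bracket N X M e h g \<omega>"
    using Phi_bracket_AE[OF h g] by eventually_elim simp
  have "Phi_integral N X M e h g \<in> borel_measurable N" "Phi_integral N X M e g h \<in> borel_measurable N"
    unfolding Phi_integral_def phi11_eq phi2_eq
    by (intro L2_spaceD(1) L2_space_add phi11.T_L2 phi2.T_L2 L2)+
  then have "(\<lambda>\<omega>. Phi_integral N X M e h g \<omega> + Phi_integral N X M e g h \<omega> + Phi_bracket N X M e h g \<omega>)
      \<in> L2_space N"
    using prod ae unfolding L2_eq_def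
    by (elim conjE) (rule L2_space_cong_AE, assumption,
        intro borel_measurable_add Phi_bracket_measurable h g, assumption+)
  with prod ae have "L2_eq N
      (\<lambda>\<omega>. Phi_integral N X M e h g \<omega> + Phi_integral N X M e g h \<omega> + L2_inner M h g)
      (\<lambda>\<omega>. Phi_integral N X M e h g \<omega> + Phi_integral N X M e g h \<omega> + Phi_bracket N X M e h g \<omega>)"
    by (simp add: L2_eq_def)
  with prod show ?thesis by (rule L2_eq_trans)
qed

end

section \<open>The product formula under the stated moment hypotheses\<close>

theorem mainTheorem18:
  fixes \<nu> :: "'e::real_normed_vector measure"
    and X :: "nat \<Rightarrow> 'e \<Rightarrow> real"
    and \<mu> :: "real measure"
    and e :: "nat \<Rightarrow> real \<Rightarrow> real"
    and h g :: "real \<Rightarrow> real"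
  assumes "prob_space \<nu>" and "space \<nu> = UNIV"
    and "prob_space.indep_vars \<nu> (\<lambda>_. borel) X {1..}"
    and "\<And>k. k \<ge> 1 \<Longrightarrow> prob_space.expectation \<nu> (X k) = 0"
    and "\<And>k. k \<ge> 1 \<Longrightarrow> prob_space.variance \<nu> (X k) = 1"
    and "\<And>p::real. p > 1 \<Longrightarrow>
           \<exists>K::real. (SUP k\<in>{1..}. \<integral>\<^sup>+\<omega>. ennreal (\<bar>X k \<omega>\<bar> powr p) \<partial>\<nu>) < ennreal K"
    and "prob_space \<mu>" and "sets \<mu> = sets borel"
    and diffuse: "\<And>x. emeasure \<mu> {x} = 0"
    and carried_by_unit_interval: "emeasure \<mu> {0..1} = 1"
    and "hilbert_basis \<mu> e"
    and "h \<in> L2_space \<mu>" and "g \<in> L2_space \<mu>"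
  shows "L2_eq \<nu>
           (\<lambda>\<omega>. Phi \<nu> X \<mu> e h \<omega> * Phi \<nu> X \<mu> e g \<omega>)
           (\<lambda>\<omega>. Phi_integral \<nu> X \<mu> e h g \<omega> + Phi_integral \<nu> X \<mu> e g h \<omega>
              + Phi_bracket \<nu> X \<mu> e h g \<omega>)"
proof -
  interpret N: prob_space \<nu> by fact
  interpret M: prob_space \<mu> by fact
  obtain K :: real where K: "(SUP k\<in>{1..}. \<integral>\<^sup>+\<omega>. ennreal (\<bar>X k \<omega>\<bar> powr 4) \<partial>\<nu>) < ennreal K"
    using assms(6)[of 4] by auto
  have X [measurable]: "X k \<in> borel_measurable \<nu>" if "k \<ge> 1" for k
    using assms(3) that by (simp add: N.indep_vars_def)
  \<comment> \<open>A strict upper bound in the extended nonnegative reals is positive, and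
    \<open>ennreal\<close> sends every nonpositive real to 0. Positivity allows the moment bound to
    be read back in the reals.\<close>
  have "0 < K" using K by (metis ennreal_neg less_le_not_le not_le zero_le)
  \<comment> \<open>The bound is first stated for the nonnegative integral, from which integrability
    is then deduced.\<close>
  have fourth: "(\<integral>\<^sup>+\<omega>. ennreal ((X k \<omega>) ^ 4) \<partial>\<nu>) < ennreal K" if "k \<ge> 1" for k
  proof -
    have "(\<integral>\<^sup>+\<omega>. ennreal ((X k \<omega>) ^ 4) \<partial>\<nu>) = (\<integral>\<^sup>+\<omega>. ennreal (\<bar>X k \<omega>\<bar> powr 4) \<partial>\<nu>)"
      by simp
    also have "\<dots> \<le> (SUP k\<in>{1..}. \<integral>\<^sup>+\<omega>. ennreal (\<bar>X k \<omega>\<bar> powr 4) \<partial>\<nu>)"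
      using that by (intro SUP_upper) auto
    finally show ?thesis using K by (rule le_less_trans)
  qed
  interpret unit_chaos_setting \<nu> X K \<mu> e
  proof
    fix k :: nat assume k: "k \<ge> 1"
    show "N.expectation (X k) = 0" by (rule assms(4)[OF k])
    show "N.expectation (\<lambda>\<omega>. (X k \<omega>)\<^sup>2) = 1"
      \<comment> \<open>The mean is zero, so the variance is the second moment.\<close>
      using assms(5)[OF k] by (simp add: assms(4)[OF k])
    show int: "integrable \<nu> (\<lambda>\<omega>. (X k \<omega>) ^ 4)"
    proof (rule integrableI_bounded)
      show "(\<lambda>\<omega>. (X k \<omega>) ^ 4) \<in> borel_measurable \<nu>" using X[OF k] by measurable
      show "(\<integral>\<^sup>+\<omega>. ennreal (norm ((X k \<omega>) ^ 4)) \<partial>\<nu>) < \<infinity>"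
        using fourth[OF k] by (simp add: order.strict_trans)
    qed
    have "ennreal (N.expectation (\<lambda>\<omega>. (X k \<omega>) ^ 4)) = (\<integral>\<^sup>+\<omega>. ennreal ((X k \<omega>) ^ 4) \<partial>\<nu>)"
      using int by (intro nn_integral_eq_integral[symmetric]) auto
    then show "N.expectation (\<lambda>\<omega>. (X k \<omega>) ^ 4) \<le> K"
      using fourth[OF k] \<open>0 < K\<close> by (metis ennreal_le_iff less_imp_le)
  qed (use assms in auto)
  show ?thesis by (rule product_formula) fact+
qed

end
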